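(* Let $H$ be a Pisot substitution in $\mathbb{R}^d$. Then for every substitution tiling $\tau\in X_H$ of $H$ and every separated net $Y\subseteq\mathbb{R}^d$ corresponding to $\tau$, there exist a constant $\beta>0$ and a bijection $\Phi:Y\to\beta\cdot\mathbb{Z}^d$ that is a bounded displacement, i.e. $$\sup_{y\in Y}\|\Phi(y)-y\|<\infty .$$
   Context: Separated net: a set $Y\subseteq\mathbb{R}^d$ is a separated net (Delone set) if there are constants $R,r>0$ such that every ball of radius $R$ intersects $Y$ and every ball of radius $r$ contains at most one point of $Y$. $\|\cdot\|$ is any norm on $\mathbb{R}^d$. Tilings: a tile is a subset of $\mathbb{R}^d$ homeomorphic to a closed $d$-dimensional ball. A tiling of $U\subseteq\mathbb{R}^d$ is a countable collection of tiles with pairwise disjoint interiors whose union is $U$. Two tiles (or patches) are translation equivalent if one is a translate of the other; representatives of the classes of tiles are called prototiles. A patch is a tiling of a bounded set $U$, and $U$ is called its support $\mathrm{supp}(P)$. Substitution: let $\xi>1$ and let $\mathcal{T}=\{S_1,\dots,S_k\}$ be a finite set of $d$-dimensional prototiles (pairwise not translation equivalent). A substitution $H$ in $\mathbb{R}^d$ with inflation constant $\xi$ assigns to each $S_i$ a patch $H(S_i)$ with $\mathrm{supp}(H(S_i))=S_i$, all of whose tiles are translates of the scaled prototiles $\xi^{-1}S_1,\dots,\xi^{-1}S_k$. $H$ is extended to translates (and scalings) of prototiles, and to patches and tilings, by applying it separately to every tile; $\xi H$ means applying $H$ and then dilating by $\xi$. Substitution tilings: $X_H$ is the set of all tilings of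 $\mathbb{R}^d$ by translates of prototiles of $\mathcal{T}$ such that every patch of the tiling is, up to translation, a sub-patch of $(\xi H)^m(S_i)$ for some $m\in\mathbb{N}$ and $i\in\{1,\dots,k\}$. Elements of $X_H$ are called substitution tilings of $H$. Primitivity: let $B_H=(b_{ij})$ be the $k\times k$ matrix where $b_{ij}$ is the number of tiles in $\xi H(S_j)$ translation equivalent to $S_i$. $H$ is primitive if some power $B_H^m$ has all entries positive. Substitution matrix: write $S_i\sim S_j$ if there is an isometry $O$ of $\mathbb{R}^d$ with $S_i=O(S_j)$ and $H(S_i)=O(H(S_j))$. Representatives $T_1,\dots,T_n$ ($n\le k$) of the equivalence classes are called basic tiles. The substitution matrix $A_H=(a_{ij})$ is the $n\times n$ matrix where $a_{ij}$ is the number of tiles in $\xi H(T_j)$ that are equivalent to $T_i$ (i.e. translates of a prototile $S$ with $S\sim T_i$). Pisot substitution: a primitive substitution $H$ such that $|\lambda_2|<1$, where $\lambda_2$ is an eigenvalue of $A_H$ which is second in absolute value (eigenvalues counted with multiplicity, the first being the Perron–Frobenius eigenvalue). Net corresponding to a tiling: a separated net $Y$ corresponds to a tiling $\tau$ of $\mathbb{R}^d$ if it is obtained by placing one point in each tile of $\tau$, i.e. there is a bijection $T\mapsto y_T$ from the tiles of $\tau$ onto $Y$ with $y_T\in T$ for every tile $T$.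
   Formalization: The substitution matrix A_H is assumed to be well defined: if S∼S', then ξH(S) and ξH(S') contain equally many tiles of each equivalence class. This does not follow from the definition of ∼, and without it the claim can fail. *)

theory Defs
  imports "HOL-Analysis.Analysis" "Jordan_Normal_Form.Char_Poly"
begin

(* Both HOL-Analysis and Jordan_Normal_Form use "$"; it is kept for components of real ^ 'n. *)
no_notation vec_index (infixl "$" 100)

definition is_norm :: "('a::real_vector \<Rightarrow> real) \<Rightarrow> bool" where
  "is_norm N \<longleftrightarrow>
     (\<forall>x. 0 \<le> N x) \<and> (\<forall>x. N x = 0 \<longleftrightarrow> x = 0) \<and>
     (\<forall>c x. N (c *\<^sub>R x) = \<bar>c\<bar> * N x) \<and> (\<forall>x y. N (x + y) \<le> N x + N y)"

definition separated_net :: "('a::real_vector \<Rightarrow> real) \<Rightarrow> 'a set \<Rightarrow> bool" where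
  "separated_net N Y \<longleftrightarrow>
     (\<exists>R>0. \<exists>r>0. \<forall>x. (\<exists>y\<in>Y. N (y - x) \<le> R) \<and>
        (\<forall>y\<in>Y. \<forall>z\<in>Y. N (y - x) \<le> r \<and> N (z - x) \<le> r \<longrightarrow> y = z))"

definition scaled_lattice :: "real \<Rightarrow> (real ^ 'd) set" where
  "scaled_lattice \<beta> = {\<beta> *\<^sub>R z |z. \<forall>i. z $ i \<in> \<int>}"


definition tile :: "(real ^ 'd) set \<Rightarrow> bool" where
  "tile T \<longleftrightarrow> T homeomorphic cball (0 :: real ^ 'd) 1"

definition tiling_of :: "(real ^ 'd) set set \<Rightarrow> (real ^ 'd) set \<Rightarrow> bool" where
  "tiling_of P U \<longleftrightarrow>
     countable P \<and> (\<forall>T\<in>P. tile T) \<and>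
     pairwise (\<lambda>S T. interior S \<inter> interior T = {}) P \<and> \<Union>P = U"

definition patch :: "(real ^ 'd) set set \<Rightarrow> bool" where
  "patch P \<longleftrightarrow> tiling_of P (\<Union>P) \<and> bounded (\<Union>P)"

definition translate :: "real ^ 'd \<Rightarrow> (real ^ 'd) set \<Rightarrow> (real ^ 'd) set" where
  "translate v T = (\<lambda>x. v + x) ` T"

definition dilate :: "real \<Rightarrow> (real ^ 'd) set \<Rightarrow> (real ^ 'd) set" where
  "dilate c T = (\<lambda>x. c *\<^sub>R x) ` T"

definition translation_equiv :: "(real ^ 'd) set \<Rightarrow> (real ^ 'd) set \<Rightarrow> bool" where
  "translation_equiv S T \<longleftrightarrow> (\<exists>v. S = translate v T)"


(* Ss lists the prototiles; only the values of H at prototiles matter. *)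
definition substitution ::
  "real \<Rightarrow> (real ^ 'd) set list \<Rightarrow> ((real ^ 'd) set \<Rightarrow> (real ^ 'd) set set) \<Rightarrow> bool" where
  "substitution \<xi> Ss H \<longleftrightarrow>
     1 < \<xi> \<and> Ss \<noteq> [] \<and> (\<forall>S\<in>set Ss. tile S) \<and>
     (\<forall>i<length Ss. \<forall>j<length Ss. i \<noteq> j \<longrightarrow> \<not> translation_equiv (Ss ! i) (Ss ! j)) \<and>
     (\<forall>S\<in>set Ss. patch (H S) \<and> \<Union>(H S) = S \<and>
        (\<forall>T\<in>H S. \<exists>S'\<in>set Ss. translation_equiv T (dilate (1 / \<xi>) S')))"

(* H extended to a translate T of a prototile; by translation inequivalence of the prototiles
   (which are bounded and nonempty) there is exactly one such S and v. *)
definition subst_tile ::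
  "(real ^ 'd) set list \<Rightarrow> ((real ^ 'd) set \<Rightarrow> (real ^ 'd) set set) \<Rightarrow>
   (real ^ 'd) set \<Rightarrow> (real ^ 'd) set set" where
  "subst_tile Ss H T = {translate v T' |v S T'. S \<in> set Ss \<and> T = translate v S \<and> T' \<in> H S}"

(* The map \<xi>H on collections of translates of prototiles.  Its values again consist of
   translates of prototiles, so iterating it never requires H on rescaled tiles. *)
definition inflate_subst ::
  "real \<Rightarrow> (real ^ 'd) set list \<Rightarrow> ((real ^ 'd) set \<Rightarrow> (real ^ 'd) set set) \<Rightarrow>
   (real ^ 'd) set set \<Rightarrow> (real ^ 'd) set set" where
  "inflate_subst \<xi> Ss H P = dilate \<xi> ` (\<Union>T\<in>P. subst_tile Ss H T)"

definition substitution_tilings ::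
  "real \<Rightarrow> (real ^ 'd) set list \<Rightarrow> ((real ^ 'd) set \<Rightarrow> (real ^ 'd) set set) \<Rightarrow>
   (real ^ 'd) set set set" where
  "substitution_tilings \<xi> Ss H =
     {\<tau>. tiling_of \<tau> UNIV \<and> (\<forall>T\<in>\<tau>. \<exists>S\<in>set Ss. translation_equiv T S) \<and>
        (\<forall>P. P \<subseteq> \<tau> \<and> patch P \<longrightarrow>
           (\<exists>m. \<exists>S\<in>set Ss. \<exists>v. translate v ` P \<subseteq> (inflate_subst \<xi> Ss H ^^ m) {S}))}"


definition prototile_matrix ::
  "real \<Rightarrow> (real ^ 'd) set list \<Rightarrow> ((real ^ 'd) set \<Rightarrow> (real ^ 'd) set set) \<Rightarrow> nat mat" where
  "prototile_matrix \<xi> Ss H = Matrix.mat (length Ss) (length Ss)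
     (\<lambda>(i, j). card {T \<in> inflate_subst \<xi> Ss H {Ss ! j}. translation_equiv T (Ss ! i)})"

definition primitive_substitution ::
  "real \<Rightarrow> (real ^ 'd) set list \<Rightarrow> ((real ^ 'd) set \<Rightarrow> (real ^ 'd) set set) \<Rightarrow> bool" where
  "primitive_substitution \<xi> Ss H \<longleftrightarrow> substitution \<xi> Ss H \<and>
     (\<exists>m. \<forall>i<length Ss. \<forall>j<length Ss. 0 < (prototile_matrix \<xi> Ss H ^\<^sub>m m) $$ (i, j))"

definition prototile_equiv ::
  "((real ^ 'd) set \<Rightarrow> (real ^ 'd) set set) \<Rightarrow> (real ^ 'd) set \<Rightarrow> (real ^ 'd) set \<Rightarrow> bool" where
  "prototile_equiv H S S' \<longleftrightarrow>
     (\<exists>f. (\<forall>x y. dist (f x) (f y) = dist x y) \<and> S = f ` S' \<and> H S = (\<lambda>T. f ` T) ` H S')"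

definition basic_tiles ::
  "(real ^ 'd) set list \<Rightarrow> ((real ^ 'd) set \<Rightarrow> (real ^ 'd) set set) \<Rightarrow>
   (real ^ 'd) set list \<Rightarrow> bool" where
  "basic_tiles Ss H Ts \<longleftrightarrow> distinct Ts \<and> set Ts \<subseteq> set Ss \<and>
     (\<forall>S\<in>set Ss. \<exists>!T. T \<in> set Ts \<and> prototile_equiv H S T)"

definition equiv_tile_count ::
  "real \<Rightarrow> (real ^ 'd) set list \<Rightarrow> ((real ^ 'd) set \<Rightarrow> (real ^ 'd) set set) \<Rightarrow>
   (real ^ 'd) set \<Rightarrow> (real ^ 'd) set \<Rightarrow> nat" where
  "equiv_tile_count \<xi> Ss H T S =
     card {T' \<in> inflate_subst \<xi> Ss H {S}.
             \<exists>S'\<in>set Ss. prototile_equiv H S' T \<and> translation_equiv T' S'}"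

definition substitution_matrix ::
  "real \<Rightarrow> (real ^ 'd) set list \<Rightarrow> ((real ^ 'd) set \<Rightarrow> (real ^ 'd) set set) \<Rightarrow>
   (real ^ 'd) set list \<Rightarrow> nat mat" where
  "substitution_matrix \<xi> Ss H Ts = Matrix.mat (length Ts) (length Ts)
     (\<lambda>(i, j). equiv_tile_count \<xi> Ss H (Ts ! i) (Ts ! j))"

(* The entries of the substitution matrix depend only on the classes of the basic tiles, not on
   the representatives chosen.  This does not follow from the definition of prototile_equiv: the
   isometry taking H S' to H S may take tiles of H S' to isometric tiles that are substituted
   differently, hence are inequivalent. *)
definition substitution_matrix_well_defined ::
  "real \<Rightarrow> (real ^ 'd) set list \<Rightarrow> ((real ^ 'd) set \<Rightarrow> (real ^ 'd) set set) \<Rightarrow> bool" where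
  "substitution_matrix_well_defined \<xi> Ss H \<longleftrightarrow>
     (\<forall>S\<in>set Ss. \<forall>S'\<in>set Ss. prototile_equiv H S S' \<longrightarrow>
        (\<forall>T\<in>set Ss. equiv_tile_count \<xi> Ss H T S = equiv_tile_count \<xi> Ss H T S'))"

(* es lists the eigenvalues with algebraic multiplicity, by decreasing absolute value.
   A matrix of size 1 has no second eigenvalue. *)
definition second_eigenvalue :: "complex mat \<Rightarrow> complex \<Rightarrow> bool" where
  "second_eigenvalue A l \<longleftrightarrow>
     (\<exists>es. char_poly A = (\<Prod>e\<leftarrow>es. [:- e, 1:]) \<and>
        sorted_wrt (\<lambda>a b. cmod b \<le> cmod a) es \<and> 1 < length es \<and> l = es ! 1)"

definition pisot_substitution ::
  "real \<Rightarrow> (real ^ 'd) set list \<Rightarrow> ((real ^ 'd) set \<Rightarrow> (real ^ 'd) set set) \<Rightarrow> bool" where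
  "pisot_substitution \<xi> Ss H \<longleftrightarrow>
     primitive_substitution \<xi> Ss H \<and> substitution_matrix_well_defined \<xi> Ss H \<and>
     (\<forall>Ts l. basic_tiles Ss H Ts \<and>
        second_eigenvalue (map_mat of_nat (substitution_matrix \<xi> Ss H Ts)) l \<longrightarrow> cmod l < 1)"


definition net_of_tiling :: "(real ^ 'd) set set \<Rightarrow> (real ^ 'd) set \<Rightarrow> bool" where
  "net_of_tiling \<tau> Y \<longleftrightarrow> (\<exists>y. bij_betw y \<tau> Y \<and> (\<forall>T\<in>\<tau>. y T \<in> T))"

end

theory Submission
  imports Defs "Jordan_Normal_Form.Schur_Decomposition"
begin

text \<open>
  Let \<open>\<alpha>\<close> be the density of the tiles of \<open>\<tau>\<close>.  It suffices to match the tiles with the points of a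
  cubic lattice of covolume \<open>1 / \<alpha>\<close> so that partners stay at bounded distance.  By a two-sided
  Hall theorem for locally finite relations (\<open>Hall_two_sided\<close>) this becomes a counting problem:
  a finite set of tiles must see enough lattice points nearby, and a finite set of lattice points
  enough tiles.

  For both counts the finite set is enlarged to a union \<open>G\<close> of large cubes of side \<open>s\<close>.  The number
  of tiles inside \<open>G\<close> differs from \<open>\<alpha> vol(G)\<close> by at most a constant times the number of tiles
  that meet the boundary of \<open>G\<close> (\<open>tiling_discrepancy\<close>).  By a volume count there are
  \<open>o(s\<^sup>d)\<close> of the latter for every cube adjacent to \<open>G\<close> (\<open>card_meeting_frontier_cubes\<close>,
  \<open>frontier_bound_small\<close>), whereas each adjacent cube offers \<open>s\<^sup>d\<close> units of volume.  So if \<open>s\<close> is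
  large, one layer of adjacent cubes outweighs every discrepancy (\<open>tiles_to_lattice\<close>).

  The Pisot condition enters in the discrepancy estimate.  The tiles meeting \<open>G\<close> lie in a supertile,
  that is, in an iterated inflation of a prototile, which is organised in levels.  A supertile of
  level \<open>j\<close> contains \<open>\<alpha>\<close> times its volume many tiles up to an error \<open>\<epsilon>\<^sub>j\<close>, where \<open>\<Sum>\<epsilon>\<^sub>j < \<infinity>\<close>
  (\<open>tile_count_expansion\<close>).  Cut the large supertile into the maximal supertiles that avoid the
  boundary of \<open>G\<close>, and the single tiles that meet it.  The parent of a maximal supertile meets the
  boundary, so it contains a tile that meets the boundary, and distinct parents of the same level
  contain distinct tiles.  Hence each level contributes at most a constant times \<open>b \<epsilon>\<^sub>j\<close>, where \<open>b\<close>
  is the number of tiles that meet the boundary, and all levels together contribute at most a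
  constant times \<open>b\<close> (\<open>supertile_discrepancy\<close>).

  The expansion of the tile counts is linear algebra.  The volumes of the basic tiles form an
  eigenvector of the transposed substitution matrix for the eigenvalue \<open>\<xi>\<^sup>d > 1\<close>, which therefore
  is the first one, all others being smaller than \<open>1\<close> in absolute value.  Triangularise the matrix
  with \<open>\<xi>\<^sup>d\<close> in the last place of the diagonal, and subtract from the count vector the multiple of
  the volume vector that cancels its last coordinate: what remains is summable under iteration
  (\<open>dominant_eigenvector_expansion\<close>).  That the volumes form an eigenvector requires the boundaries
  of tiles to be null sets (\<open>negligible_frontier_copy\<close>), and they are constant on the classes of
  prototiles because isometries preserve volume (\<open>isometry_measure_le\<close>).
\<close>

(* The components of a vector of type 'a Matrix.vec are written with vec_index, so that "$" always
   refers to vectors of type 'a ^ 'n. *)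
no_notation vec_index (infixl "$" 100)

section \<open>Matchings in locally finite relations\<close>

text \<open>Rado's argument.  Zorn's lemma gives a maximal set \<open>M\<close> of candidate pairs \<open>(i, x)\<close> whose removal
  preserves Hall's condition; the condition passes to unions of chains because a finite \<open>J\<close> involves
  only finitely many pairs.  If two candidates \<open>x\<close>, \<open>y\<close> remained for one \<open>i\<close>, then maximality would
  give finite sets \<open>J\<close>, \<open>K\<close> that become critical on removing \<open>(i, x)\<close> and \<open>(i, y)\<close>, and counting
  the union and the intersection of their neighbourhoods would contradict Hall's condition.\<close>
theorem Rado_transversal:
  fixes F :: "'a \<Rightarrow> 'b set"
  assumes fin: "\<And>i. i \<in> I \<Longrightarrow> finite (F i)"
    and hall: "\<And>J. J \<subseteq> I \<Longrightarrow> finite J \<Longrightarrow> card J \<le> card (\<Union>(F ` J))"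
  shows "\<exists>f. inj_on f I \<and> (\<forall>i\<in>I. f i \<in> F i)"
proof -
  define S where "S = Sigma I F"
  define A where "A = {X. X \<subseteq> S \<and> (\<forall>J. J \<subseteq> I \<longrightarrow> finite J \<longrightarrow> card J \<le> card ((S - X) `` J))}"
  have finS: "finite ((S - X) `` J)" if "J \<subseteq> I" "finite J" for X J
  proof (rule finite_subset)
    show "(S - X) `` J \<subseteq> \<Union>(F ` J)" by (auto simp: S_def)
    show "finite (\<Union>(F ` J))" using that fin by auto
  qed
  have "\<exists>M\<in>A. \<forall>X\<in>A. M \<subseteq> X \<longrightarrow> X = M"
  proof (rule subset_Zorn_nonempty)
    have "S `` J = \<Union>(F ` J)" if "J \<subseteq> I" for J
      using that by (auto simp: S_def)
    then have "{} \<in> A" using hall by (auto simp: A_def)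
    then show "A \<noteq> {}" by blast
  next
    fix C assume C: "C \<noteq> {}" "subset.chain A C"
    have "card J \<le> card ((S - \<Union>C) `` J)" if J: "J \<subseteq> I" "finite J" for J
    proof -
      have fin': "finite (\<Union>C \<inter> Sigma J F)"
      proof (rule finite_subset)
        show "finite (Sigma J F)" using J fin by (intro finite_SigmaI) blast+
      qed blast
      have sub: "\<Union>C \<inter> Sigma J F \<subseteq> \<Union>C" by blast
      obtain X where X: "X \<in> C" "\<Union>C \<inter> Sigma J F \<subseteq> X"
        by (rule finite_subset_Union_chain[OF fin' sub C])
      have "(S - \<Union>C) `` J = (S - X) `` J"
        using X J by (auto simp: S_def)
      moreover have "X \<in> A" using X C by (auto simp: subset.chain_def)
      ultimately show ?thesis using J by (auto simp: A_def)
    qed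
    moreover have "\<Union>C \<subseteq> S" using C by (auto simp: subset.chain_def A_def)
    ultimately show "\<Union>C \<in> A" by (auto simp: A_def)
  qed
  then obtain M where M: "M \<in> A" and maxM: "\<And>X. X \<in> A \<Longrightarrow> M \<subseteq> X \<Longrightarrow> X = M"
    by blast
  define N where "N J = (S - M) `` J" for J
  have cardN: "card J \<le> card (N J)" if "J \<subseteq> I" "finite J" for J
    using M that by (auto simp: A_def N_def)
  have finN: "finite (N J)" if "J \<subseteq> I" "finite J" for J
    using finS that by (auto simp: N_def)
  have tight: "\<exists>J. J \<subseteq> I \<and> finite J \<and> i \<notin> J \<and> card (N J \<union> (N {i} - {x})) \<le> card J"
    if i: "i \<in> I" and x: "x \<in> N {i}" for i x
  proof -
    have "insert (i, x) M \<noteq> M" using x by (auto simp: N_def)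
    then have "insert (i, x) M \<notin> A" using maxM by blast
    moreover have "insert (i, x) M \<subseteq> S" using x M by (auto simp: N_def A_def)
    ultimately obtain J where J: "J \<subseteq> I" "finite J"
      and less: "card ((S - insert (i, x) M) `` J) < card J"
      unfolding A_def mem_Collect_eq not_le[symmetric] by blast
    have "i \<in> J"
    proof (rule ccontr)
      assume "i \<notin> J"
      then have "(S - insert (i, x) M) `` J = N J" by (auto simp: N_def)
      then show False using less cardN[OF J] by simp
    qed
    have "(S - insert (i, x) M) `` J = N (J - {i}) \<union> (N {i} - {x})"
      unfolding N_def using \<open>i \<in> J\<close> by blast
    moreover have "card J = Suc (card (J - {i}))"
      using card.remove[OF J(2) \<open>i \<in> J\<close>] by simp
    ultimately have "card (N (J - {i}) \<union> (N {i} - {x})) \<le> card (J - {i})"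
      using less by simp
    then show ?thesis using J by (intro exI[of _ "J - {i}"]) auto
  qed
  have single: "x = y" if i: "i \<in> I" and x: "x \<in> N {i}" and y: "y \<in> N {i}" for i x y
  proof (rule ccontr)
    assume "x \<noteq> y"
    obtain J where J: "J \<subseteq> I" "finite J" "i \<notin> J" and cJ: "card (N J \<union> (N {i} - {x})) \<le> card J"
      using tight[OF i x] by blast
    obtain K where K: "K \<subseteq> I" "finite K" "i \<notin> K" and cK: "card (N K \<union> (N {i} - {y})) \<le> card K"
      using tight[OF i y] by blast
    let ?A = "N J \<union> (N {i} - {x})" and ?B = "N K \<union> (N {i} - {y})"
    have f: "finite ?A" "finite ?B" using J K i finN by auto
    have "?A \<union> ?B = N (insert i (J \<union> K))"
      using \<open>x \<noteq> y\<close> by (auto simp: N_def)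
    then have "Suc (card (J \<union> K)) \<le> card (?A \<union> ?B)"
      using cardN[of "insert i (J \<union> K)"] J K i by simp
    moreover have "card (J \<inter> K) \<le> card (?A \<inter> ?B)"
    proof -
      have "N (J \<inter> K) \<subseteq> ?A \<inter> ?B" by (auto simp: N_def)
      then have "card (N (J \<inter> K)) \<le> card (?A \<inter> ?B)" using f by (intro card_mono) auto
      then show ?thesis using cardN[of "J \<inter> K"] J by (auto intro: order_trans)
    qed
    moreover have "card ?A + card ?B = card (?A \<union> ?B) + card (?A \<inter> ?B)"
      using f by (rule card_Un_Int)
    moreover have "card J + card K = card (J \<union> K) + card (J \<inter> K)"
      using J K by (intro card_Un_Int) auto
    ultimately show False using cJ cK by linarith
  qed
  have "\<exists>x. x \<in> N {i}" if "i \<in> I" for i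
    using cardN[of "{i}"] that by (cases "N {i} = {}") auto
  then obtain f where f: "\<And>i. i \<in> I \<Longrightarrow> f i \<in> N {i}" by metis
  have "inj_on f I"
  proof (rule inj_onI, rule ccontr)
    fix i j assume ij: "i \<in> I" "j \<in> I" "f i = f j" "i \<noteq> j"
    have "N {i, j} \<subseteq> {f i}"
    proof
      fix z assume "z \<in> N {i, j}"
      then have "z \<in> N {i} \<or> z \<in> N {j}" by (auto simp: N_def)
      then show "z \<in> {f i}"
        using single[OF ij(1) f[OF ij(1)], of z] single[OF ij(2) f[OF ij(2)], of z] ij(3) by auto
    qed
    then have "card (N {i, j}) \<le> 1" using card_mono[of "{f i}"] by fastforce
    then show False using cardN[of "{i, j}"] ij by simp
  qed
  moreover have "\<forall>i\<in>I. f i \<in> F i" using f by (auto simp: N_def S_def)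
  ultimately show ?thesis by blast
qed

text \<open>The bijection of the Schroeder--Bernstein theorem pairs elements only as \<open>f\<close> or \<open>g\<close> does, so it
  stays within every relation that contains both maps.\<close>
lemma Schroeder_Bernstein_within:
  assumes f: "inj_on f A" "f ` A \<subseteq> B" and g: "inj_on g B" "g ` B \<subseteq> A"
  shows "\<exists>h. bij_betw h A B \<and> (\<forall>a\<in>A. h a = f a \<or> g (h a) = a)"
proof -
  define X where "X = lfp (\<lambda>X. A - g ` (B - f ` X))"
  have "mono (\<lambda>X. A - g ` (B - f ` X))" by (intro monoI) blast
  then have X: "X = A - g ` (B - f ` X)" unfolding X_def by (rule lfp_unfold)
  have XA: "X \<subseteq> A" using X by blast
  have AX: "A - X = g ` (B - f ` X)" using X g by blast
  define h where "h a = (if a \<in> X then f a else inv_into B g a)" for a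
  have "bij_betw f X (f ` X)" using f XA by (meson bij_betw_imageI inj_on_subset)
  then have 1: "bij_betw h X (f ` X)" by (simp add: h_def cong: bij_betw_cong)
  have "bij_betw (inv_into B g) (A - X) (B - f ` X)"
    unfolding AX using g(1)
    by (intro bij_betw_inv_into_subset[of g B "g ` B"]) (auto simp: inj_on_imp_bij_betw)
  then have 2: "bij_betw h (A - X) (B - f ` X)"
    by (rule bij_betw_cong[THEN iffD1, rotated]) (simp add: h_def)
  have "bij_betw h (X \<union> (A - X)) (f ` X \<union> (B - f ` X))"
    using 1 2 by (rule bij_betw_combine) blast
  moreover have "X \<union> (A - X) = A" "f ` X \<union> (B - f ` X) = B" using XA f by auto
  ultimately have "bij_betw h A B" by simp
  moreover have "h a = f a \<or> g (h a) = a" if "a \<in> A" for a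
  proof (cases "a \<in> X")
    case False
    then have "a \<in> g ` B" using AX that by blast
    then show ?thesis using False by (simp add: h_def f_inv_into_f)
  qed (simp add: h_def)
  ultimately show ?thesis by blast
qed

text \<open>A transversal in either direction, and the two merged into a bijection.\<close>
theorem Hall_two_sided:
  fixes R :: "'a \<Rightarrow> 'b \<Rightarrow> bool"
  assumes finA: "\<And>a. a \<in> A \<Longrightarrow> finite {b \<in> B. R a b}"
    and finB: "\<And>b. b \<in> B \<Longrightarrow> finite {a \<in> A. R a b}"
    and hallA: "\<And>J. J \<subseteq> A \<Longrightarrow> finite J \<Longrightarrow> card J \<le> card {b \<in> B. \<exists>a\<in>J. R a b}"
    and hallB: "\<And>J. J \<subseteq> B \<Longrightarrow> finite J \<Longrightarrow> card J \<le> card {a \<in> A. \<exists>b\<in>J. R a b}"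
  shows "\<exists>h. bij_betw h A B \<and> (\<forall>a\<in>A. R a (h a))"
proof -
  have "\<Union>((\<lambda>a. {b \<in> B. R a b}) ` J) = {b \<in> B. \<exists>a\<in>J. R a b}" for J by blast
  then obtain f where f: "inj_on f A" "\<forall>a\<in>A. f a \<in> {b \<in> B. R a b}"
    using Rado_transversal[of A "\<lambda>a. {b \<in> B. R a b}"] finA hallA by auto
  have "\<Union>((\<lambda>b. {a \<in> A. R a b}) ` J) = {a \<in> A. \<exists>b\<in>J. R a b}" for J by blast
  then obtain g where g: "inj_on g B" "\<forall>b\<in>B. g b \<in> {a \<in> A. R a b}"
    using Rado_transversal[of B "\<lambda>b. {a \<in> A. R a b}"] finB hallB by auto
  obtain h where h: "bij_betw h A B" "\<forall>a\<in>A. h a = f a \<or> g (h a) = a"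
    using Schroeder_Bernstein_within[of f A B g] f g by auto
  have "R a (h a)" if "a \<in> A" for a
  proof -
    have "h a \<in> B" using h(1) that by (auto dest: bij_betwE)
    then show ?thesis using h(2) f(2) g(2) that by force
  qed
  then show ?thesis using h by blast
qed

section \<open>Iteration of matrices with one dominant eigenvalue\<close>

text \<open>Every partial sum \<open>s\<close> of \<open>\<Sum>\<bar>a\<^sub>m\<bar>\<close> satisfies \<open>s \<le> \<bar>a\<^sub>0\<bar> + \<bar>e\<bar> s + \<Sum>\<bar>b\<^sub>m\<bar>\<close>, which bounds it since
  \<open>\<bar>e\<bar> < 1\<close>.\<close>
lemma summable_affine_recursion:
  fixes a b :: "nat \<Rightarrow> complex"
  assumes rec: "\<And>m. a (Suc m) = e * a m + b m"
    and e: "cmod e < 1" and b: "summable (\<lambda>m. cmod (b m))"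
  shows "summable (\<lambda>m. cmod (a m))"
proof (rule summableI_nonneg_bounded)
  fix k
  let ?S = "\<lambda>k. \<Sum>m<k. cmod (a m)"
  have "?S (Suc k) = cmod (a 0) + (\<Sum>m<k. cmod (e * a m + b m))"
    by (simp add: sum.lessThan_Suc_shift rec del: sum.lessThan_Suc)
  also have "\<dots> \<le> cmod (a 0) + (\<Sum>m<k. cmod e * cmod (a m) + cmod (b m))"
    by (intro add_left_mono sum_mono) (metis norm_mult norm_triangle_ineq)
  also have "\<dots> = cmod (a 0) + cmod e * ?S k + (\<Sum>m<k. cmod (b m))"
    by (simp add: sum.distrib sum_distrib_left)
  also have "\<dots> \<le> cmod (a 0) + cmod e * ?S k + (\<Sum>m. cmod (b m))"
    by (intro add_left_mono sum_le_suminf b) auto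
  finally have "?S (Suc k) \<le> cmod (a 0) + cmod e * ?S k + (\<Sum>m. cmod (b m))" .
  moreover have "?S k \<le> ?S (Suc k)" by simp
  ultimately have "?S k * (1 - cmod e) \<le> cmod (a 0) + (\<Sum>m. cmod (b m))"
    unfolding right_diff_distrib by (simp only: mult.commute[of _ "cmod e"] mult_1_right)
  then show "?S k \<le> (cmod (a 0) + (\<Sum>m. cmod (b m))) / (1 - cmod e)"
    using e by (simp add: pos_le_divide_eq)
qed auto

text \<open>Solved from the last coordinate upwards: to the \<open>i\<close>-th recursion the later coordinates are a
  summable perturbation.\<close>
lemma summable_triangular_recursion:
  fixes y :: "nat \<Rightarrow> nat \<Rightarrow> complex"
  assumes rec: "\<And>m i. i < k \<Longrightarrow> y (Suc m) i = (\<Sum>j=i..<k. B i j * y m j)"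
    and diag: "\<And>i. i < k \<Longrightarrow> cmod (B i i) < 1"
  shows "i < k \<Longrightarrow> summable (\<lambda>m. cmod (y m i))"
proof (induction "k - i" arbitrary: i rule: less_induct)
  case less
  have rec': "y (Suc m) i = B i i * y m i + (\<Sum>j=Suc i..<k. B i j * y m j)" for m
    using rec[OF less.prems] less.prems by (simp add: sum.atLeast_Suc_lessThan)
  have sum': "summable (\<lambda>m. cmod (\<Sum>j=Suc i..<k. B i j * y m j))"
  proof (rule summable_comparison_test'[of _ 0])
    show "summable (\<lambda>m. \<Sum>j=Suc i..<k. cmod (B i j) * cmod (y m j))"
      using less by (intro summable_sum summable_mult) auto
    show "norm (cmod (\<Sum>j=Suc i..<k. B i j * y m j)) \<le> (\<Sum>j=Suc i..<k. cmod (B i j) * cmod (y m j))" for m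
      by (simp add: norm_mult[symmetric] norm_sum)
  qed
  show ?case
    by (rule summable_affine_recursion[OF rec' diag[OF less.prems] sum'])
qed

text \<open>In a Schur basis whose diagonal ends with \<open>l\<close>, the last coordinate \<open>q\<close> is multiplied by \<open>l\<close> in
  every step.  So the vectors with \<open>q = 0\<close> form an invariant subspace on which only the small
  eigenvalues act, and orbits in it are summable.  Since \<open>l\<^sup>m w\<close> does not tend to \<open>0\<close>, the
  eigenvector \<open>w\<close> has \<open>q \<noteq> 0\<close>, and \<open>\<alpha> = q (X 0) / q w\<close> moves \<open>X 0 - \<alpha> w\<close> into the subspace.\<close>
lemma dominant_eigenvector_expansion:
  fixes A :: "complex mat" and X :: "nat \<Rightarrow> complex Matrix.vec"
  assumes A: "A \<in> carrier_mat n n"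
    and char: "char_poly A = (\<Prod>e\<leftarrow>l # es. [:- e, 1:])"
    and l: "1 \<le> cmod l" and small: "\<And>e. e \<in> set es \<Longrightarrow> cmod e < 1"
    and w: "w \<in> carrier_vec n" "A *\<^sub>v w = l \<cdot>\<^sub>v w" "w \<noteq> 0\<^sub>v n"
    and X: "\<And>m. X m \<in> carrier_vec n" "\<And>m. X (Suc m) = A *\<^sub>v X m"
  shows "\<exists>\<alpha>. \<forall>i<n. summable (\<lambda>m. cmod (vec_index (X m) i - \<alpha> * l ^ m * vec_index w i))"
proof -
  obtain B P Q where BPQ: "schur_decomposition A (es @ [l]) = (B, P, Q)"
    by (metis prod_cases3)
  have "char_poly A = (\<Prod>e\<leftarrow>es @ [l]. [:- e, 1:])" using char by (simp add: mult.commute)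
  from schur_decomposition[OF A this BPQ]
  have wit: "similar_mat_wit A B P Q" and tri: "upper_triangular B" and diag: "diag_mat B = es @ [l]"
    by auto
  note PQ = similar_mat_witD2(1,2,5,6,7)[OF A wit] and A_eq = similar_mat_witD2(3)[OF A wit]
  have n: "n = Suc (length es)"
    using arg_cong[OF diag, of length] PQ by (simp add: diag_mat_def)
  have Bdiag: "B $$ (i, i) = (es @ [l]) ! i" if "i < n" for i
    using arg_cong[OF diag, of "\<lambda>xs. xs ! i"] that PQ by (simp add: diag_mat_def)
  define q where "q v = vec_index (Q *\<^sub>v v) (n - 1)" for v
  have step: "Q *\<^sub>v (A *\<^sub>v v) = B *\<^sub>v (Q *\<^sub>v v)" if "v \<in> carrier_vec n" for v
  proof -
    have "A *\<^sub>v v = P *\<^sub>v (B *\<^sub>v (Q *\<^sub>v v))"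
    proof -
      have "A *\<^sub>v v = (P * B) *\<^sub>v (Q *\<^sub>v v)"
        unfolding A_eq by (rule assoc_mult_mat_vec) (use PQ that in auto)
      also have "\<dots> = P *\<^sub>v (B *\<^sub>v (Q *\<^sub>v v))"
        by (rule assoc_mult_mat_vec) (use PQ that in auto)
      finally show ?thesis .
    qed
    then have "Q *\<^sub>v (A *\<^sub>v v) = (Q * P) *\<^sub>v (B *\<^sub>v (Q *\<^sub>v v))"
      using PQ that by (subst assoc_mult_mat_vec) auto
    then show ?thesis using that PQ by simp
  qed
  have coord: "vec_index (B *\<^sub>v v) i = (\<Sum>j=i..<n. B $$ (i, j) * vec_index v j)"
    if "v \<in> carrier_vec n" "i < n" for v i
  proof -
    have "vec_index (B *\<^sub>v v) i = (\<Sum>j=0..<n. B $$ (i, j) * vec_index v j)"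
      using that PQ by (auto simp: scalar_prod_def intro!: sum.cong)
    also have "\<dots> = (\<Sum>j=i..<n. B $$ (i, j) * vec_index v j)"
      using that PQ upper_triangularD[OF tri] by (intro sum.mono_neutral_right) auto
    finally show ?thesis .
  qed
  have decay: "summable (\<lambda>m. cmod (vec_index (U m) i))"
    if U: "\<And>m. U m \<in> carrier_vec n" "\<And>m. U (Suc m) = A *\<^sub>v U m" and q0: "q (U 0) = 0" and i: "i < n"
    for U i
  proof -
    define y where "y m = Q *\<^sub>v U m" for m
    have yc: "y m \<in> carrier_vec n" for m using U PQ by (simp add: y_def)
    have yS: "y (Suc m) = B *\<^sub>v y m" for m using U step by (simp add: y_def)
    have last: "vec_index (y m) (n - 1) = 0" for m
    proof (induction m)
      case 0 then show ?case using q0 by (simp add: q_def y_def)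
    next
      case (Suc m)
      have "{n - 1..<n} = {n - 1}" using n by auto
      then show ?case using Suc coord[OF yc[of m], of "n - 1"] n by (simp add: yS)
    qed
    have "vec_index (y (Suc m)) i = (\<Sum>j=i..<n - 1. B $$ (i, j) * vec_index (y m) j)" if "i < n - 1" for m i
    proof -
      have "{i..<n} = insert (n - 1) {i..<n - 1}" using that by auto
      then show ?thesis using coord[OF yc[of m], of i] that last by (simp add: yS)
    qed
    moreover have "cmod (B $$ (i, i)) < 1" if "i < n - 1" for i
      using that small n by (simp add: Bdiag nth_append)
    ultimately have *: "summable (\<lambda>m. cmod (vec_index (y m) i))" if "i < n - 1" for i
      using summable_triangular_recursion[of "n - 1" "\<lambda>m i. vec_index (y m) i" "\<lambda>i j. B $$ (i, j)" i] that
      by blast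
    have ysum: "summable (\<lambda>m. cmod (vec_index (y m) i))" if "i < n" for i
    proof (cases "i = n - 1")
      case True then show ?thesis unfolding True last by simp
    next
      case False then show ?thesis using * that by simp
    qed
    have U_y: "vec_index (U m) i = (\<Sum>j=0..<n. P $$ (i, j) * vec_index (y m) j)" for m
    proof -
      have "U m = (P * Q) *\<^sub>v U m" using U(1)[of m] PQ by simp
      also have "\<dots> = P *\<^sub>v y m" using U PQ unfolding y_def by (metis assoc_mult_mat_vec)
      finally have "vec_index (U m) i = vec_index (P *\<^sub>v y m) i" by simp
      then show ?thesis using i PQ yc[of m] by (auto simp: scalar_prod_def intro!: sum.cong)
    qed
    show ?thesis
    proof (rule summable_comparison_test'[of _ 0])
      show "summable (\<lambda>m. \<Sum>j=0..<n. cmod (P $$ (i, j)) * cmod (vec_index (y m) j))"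
        using ysum by (intro summable_sum summable_mult) auto
      show "norm (cmod (vec_index (U m) i)) \<le> (\<Sum>j=0..<n. cmod (P $$ (i, j)) * cmod (vec_index (y m) j))" for m
        unfolding U_y by (simp add: norm_mult[symmetric] norm_sum)
    qed
  qed
  have lw: "l ^ Suc m \<cdot>\<^sub>v w = A *\<^sub>v (l ^ m \<cdot>\<^sub>v w)" for m
    using A w by (simp add: mult_mat_vec smult_smult_assoc mult.commute)
  have qw: "q w \<noteq> 0"
  proof
    assume "q w = 0"
    obtain i where i: "i < n" "vec_index w i \<noteq> 0"
      using w by (metis carrier_vecD eq_vecI index_zero_vec)
    have "summable (\<lambda>m. cmod (vec_index (l ^ m \<cdot>\<^sub>v w) i))"
      using \<open>q w = 0\<close> w i lw by (intro decay[of "\<lambda>m. l ^ m \<cdot>\<^sub>v w"]) auto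
    then have "(\<lambda>m. cmod (vec_index (l ^ m \<cdot>\<^sub>v w) i)) \<longlonglongrightarrow> 0" by (rule summable_LIMSEQ_zero)
    moreover have "cmod (vec_index w i) \<le> cmod (vec_index (l ^ m \<cdot>\<^sub>v w) i)" for m
    proof -
      have "1 * cmod (vec_index w i) \<le> cmod l ^ m * cmod (vec_index w i)"
        using l by (intro mult_right_mono) auto
      then show ?thesis using i w by (simp add: norm_mult norm_power)
    qed
    ultimately have "cmod (vec_index w i) \<le> 0" by (intro LIMSEQ_le_const) auto
    then show False using i by simp
  qed
  define \<alpha> where "\<alpha> = q (X 0) / q w"
  define U where "U m = X m - (\<alpha> * l ^ m) \<cdot>\<^sub>v w" for m
  have U1: "U m \<in> carrier_vec n" for m using X w by (simp add: U_def)
  have U2: "U (Suc m) = A *\<^sub>v U m" for m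
  proof -
    have "A *\<^sub>v U m = A *\<^sub>v X m - A *\<^sub>v ((\<alpha> * l ^ m) \<cdot>\<^sub>v w)"
      unfolding U_def using A X w by (intro mult_minus_distrib_mat_vec) auto
    also have "A *\<^sub>v ((\<alpha> * l ^ m) \<cdot>\<^sub>v w) = (\<alpha> * l ^ Suc m) \<cdot>\<^sub>v w"
      using A w by (simp add: mult_mat_vec smult_smult_assoc mult_ac)
    finally show ?thesis by (simp add: U_def X)
  qed
  have "Q *\<^sub>v U 0 = Q *\<^sub>v X 0 - \<alpha> \<cdot>\<^sub>v (Q *\<^sub>v w)"
  proof -
    have "Q *\<^sub>v U 0 = Q *\<^sub>v X 0 - Q *\<^sub>v (\<alpha> \<cdot>\<^sub>v w)"
      unfolding U_def using PQ X w by (simp add: mult_minus_distrib_mat_vec)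
    also have "Q *\<^sub>v (\<alpha> \<cdot>\<^sub>v w) = \<alpha> \<cdot>\<^sub>v (Q *\<^sub>v w)" using PQ w by (simp add: mult_mat_vec)
    finally show ?thesis .
  qed
  then have "q (U 0) = q (X 0) - \<alpha> * q w" using n PQ w X by (simp add: q_def)
  then have U0: "q (U 0) = 0" using qw by (simp add: \<alpha>_def)
  have "summable (\<lambda>m. cmod (vec_index (X m) i - \<alpha> * l ^ m * vec_index w i))" if "i < n" for i
    using decay[of U, OF U1 U2 U0 that] that w X by (simp add: U_def)
  then show ?thesis by blast
qed

text \<open>Put the eigenvalues in decreasing order of absolute value.  From the second on they are smaller
  than \<open>1\<close>, so the eigenvalue \<open>l \<ge> 1\<close> comes first.  If the size is \<open>1\<close>, there is no second
  eigenvalue and nothing else to control.\<close>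
lemma pisot_matrix_expansion:
  fixes A :: "nat mat" and w :: "nat \<Rightarrow> real" and c :: "nat \<Rightarrow> nat \<Rightarrow> real"
  assumes A: "A \<in> carrier_mat n n"
    and pisot: "\<And>l. second_eigenvalue (map_mat of_nat A) l \<Longrightarrow> cmod l < 1"
    and w: "\<And>j. j < n \<Longrightarrow> (\<Sum>i<n. A $$ (i, j) * w i) = l * w j" "i0 < n" "w i0 \<noteq> 0"
    and l: "1 \<le> l"
    and c: "\<And>m j. j < n \<Longrightarrow> c (Suc m) j = (\<Sum>i<n. A $$ (i, j) * c m i)"
  shows "\<exists>\<alpha>::real. \<forall>j<n. summable (\<lambda>m. \<bar>c m j - \<alpha> * l ^ m * w j\<bar>)"
proof -
  let ?A = "map_mat of_nat A :: complex mat"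
  let ?T = "transpose_mat ?A"
  let ?v = "\<lambda>f :: nat \<Rightarrow> real. Matrix.vec n (\<lambda>i. complex_of_real (f i))"
  have T: "?T \<in> carrier_mat n n" using A by simp
  have Tv: "vec_index (?T *\<^sub>v ?v f) j = of_real (\<Sum>i<n. real (A $$ (i, j)) * f i)"
    if "j < n" for j and f :: "nat \<Rightarrow> real"
    using that A by (auto simp: scalar_prod_def lessThan_atLeast0 intro!: sum.cong)
  obtain es0 where es0: "char_poly ?A = (\<Prod>e\<leftarrow>es0. [:- e, 1:])" "length es0 = n"
    using char_poly_factorized[of ?A n] A by auto
  define es where "es = rev (sort_key cmod es0)"
  have es: "char_poly ?A = (\<Prod>e\<leftarrow>es. [:- e, 1:])"
  proof -
    have "mset (map (\<lambda>e. [:- e, 1:]) es) = mset (map (\<lambda>e. [:- e, 1:]) es0)"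
      by (simp add: es_def)
    then show ?thesis unfolding es0(1) by (metis prod_mset_prod_list)
  qed
  have "sorted_wrt (\<lambda>a b. cmod a \<le> cmod b) (sort_key cmod es0)"
    by (metis sorted_sort_key sorted_wrt_map)
  then have sorted: "sorted_wrt (\<lambda>a b. cmod b \<le> cmod a) es"
    by (simp add: es_def sorted_wrt_rev)
  have len: "length es = n" using es0 by (simp add: es_def)
  have wv: "?T *\<^sub>v ?v w = of_real l \<cdot>\<^sub>v ?v w"
    using A w(1) Tv[of _ w] by (intro eq_vecI) auto
  have w0: "?v w \<noteq> 0\<^sub>v n"
    using w by (metis index_vec index_zero_vec(1) of_real_eq_0_iff)
  have "eigenvalue ?T (of_real l)"
    unfolding eigenvalue_def eigenvector_def using wv w0 A by (intro exI[of _ "?v w"]) auto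
  then have "poly (char_poly ?A) (of_real l) = 0"
    using eigenvalue_root_char_poly[OF T] char_poly_transpose_mat[of ?A n] A by simp
  then have l_in: "of_real l \<in> set es"
    unfolding es by (auto simp: poly_prod_list prod_list_zero_iff)
  obtain e es' where ees: "es = e # es'" using l_in by (cases es) auto
  have small: "cmod x < 1" if "x \<in> set es'" for x
  proof -
    obtain e' es'' where es': "es' = e' # es''" using \<open>x \<in> set es'\<close> by (cases es') auto
    have "second_eigenvalue ?A e'"
      unfolding second_eigenvalue_def using es sorted ees es' by (intro exI[of _ es]) auto
    then have "cmod e' < 1" by (rule pisot)
    moreover have "cmod x \<le> cmod e'" using that sorted ees es' by auto
    ultimately show ?thesis by simp
  qed
  have "of_real l \<notin> set es'" using small[of "of_real l"] l by auto
  then have e: "e = of_real l" using l_in ees by simp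
  have "char_poly ?T = (\<Prod>e\<leftarrow>of_real l # es'. [:- e, 1:])"
    using es ees e char_poly_transpose_mat[of ?A n] A by simp
  moreover have "?v (c (Suc m)) = ?T *\<^sub>v ?v (c m)" for m
    using A c[of _ m] Tv[of _ "c m"] by (intro eq_vecI) auto
  ultimately obtain a where a: "\<forall>i<n. summable (\<lambda>m. cmod (vec_index (?v (c m)) i - a * of_real l ^ m * vec_index (?v w) i))"
    using dominant_eigenvector_expansion[OF T, of "of_real l" es' "?v w" "\<lambda>m. ?v (c m)"] small wv w0 l
    by auto
  have "summable (\<lambda>m. \<bar>c m j - Re a * l ^ m * w j\<bar>)" if "j < n" for j
  proof (rule summable_comparison_test'[of _ 0])
    show "summable (\<lambda>m. cmod (of_real (c m j) - a * of_real l ^ m * of_real (w j)))"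
      using a that by simp
    fix m
    have "c m j - Re a * l ^ m * w j = Re (of_real (c m j) - a * of_real (l ^ m * w j))"
      by (simp add: mult.assoc)
    then show "norm \<bar>c m j - Re a * l ^ m * w j\<bar> \<le> cmod (of_real (c m j) - a * of_real l ^ m * of_real (w j))"
      using abs_Re_le_cmod[of "of_real (c m j) - a * of_real (l ^ m * w j)"]
      by (simp add: mult.assoc)
  qed
  then show ?thesis by blast
qed

section \<open>Tiles and their images under translations and dilations\<close>

lemma tile_translate:
  assumes "tile T" shows "tile (translate v T)"
proof -
  have "translate v T homeomorphic T"
    unfolding translate_def by (subst homeomorphic_sym) (rule homeomorphic_translation)
  from homeomorphic_trans[OF this assms[unfolded tile_def]] show ?thesis unfolding tile_def .
qed

lemma tile_dilate:
  assumes "tile T" "c \<noteq> 0" shows "tile (dilate c T)"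
proof -
  have "dilate c T homeomorphic T"
    unfolding dilate_def by (subst homeomorphic_sym) (rule homeomorphic_scaling[OF assms(2)])
  from homeomorphic_trans[OF this assms(1)[unfolded tile_def]] show ?thesis unfolding tile_def .
qed

lemma tile_compact:
  assumes "tile T" shows "compact T"
  using homeomorphic_compactness[OF assms[unfolded tile_def]] by simp

lemma tile_connected:
  assumes "tile T" shows "connected T"
  using homeomorphic_connectedness[OF assms[unfolded tile_def]] by simp

text \<open>A homeomorphism from the ball onto \<open>T\<close> maps the open ball to an open set, by invariance of
  domain.\<close>
lemma tile_interior_nonempty:
  fixes T :: "(real ^ 'd) set"
  assumes "tile T" shows "interior T \<noteq> {}"
proof -
  obtain f g where "homeomorphism T (cball (0 :: real ^ 'd) 1) f g"
    using assms unfolding tile_def homeomorphic_def by blast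
  then have g: "continuous_on (cball 0 1) g" "g ` cball 0 1 = T" "\<forall>x\<in>cball 0 1. f (g x) = x"
    by (auto simp: homeomorphism_def)
  have "inj_on g (ball 0 1)" using g(3) by (intro inj_on_inverseI[of _ f]) auto
  moreover have "continuous_on (ball 0 1) g"
    by (rule continuous_on_subset[OF g(1)]) auto
  ultimately have "open (g ` ball 0 1)" by (intro invariance_of_domain) auto
  moreover have "g ` ball 0 1 \<subseteq> T" using g(2) ball_subset_cball by blast
  ultimately have "g ` ball 0 1 \<subseteq> interior T" by (simp add: interior_maximal)
  then show ?thesis by auto
qed

lemma tile_nonempty: "tile T \<Longrightarrow> T \<noteq> {}"
  using tile_interior_nonempty by fastforce

lemma translate_0 [simp]: "translate 0 T = T"
  by (simp add: translate_def)

lemma translate_translate [simp]: "translate a (translate b T) = translate (a + b) T"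
  by (simp add: translate_def image_image add.assoc)

lemma dilate_1 [simp]: "dilate 1 T = T"
  by (simp add: dilate_def)

lemma dilate_dilate [simp]: "dilate a (dilate b T) = dilate (a * b) T"
  by (simp add: dilate_def image_image)

lemma dilate_translate: "dilate c (translate v T) = translate (c *\<^sub>R v) (dilate c T)"
  by (simp add: dilate_def translate_def image_image scaleR_add_right)

lemma translate_mono_iff [simp]: "translate v S \<subseteq> translate v T \<longleftrightarrow> S \<subseteq> T"
  unfolding translate_def by (rule inj_image_subset_iff) (simp add: inj_def)

lemma inj_translate: "inj (translate v)"
  by (rule injI) (simp add: translate_def inj_image_eq_iff inj_def)

lemma translate_Int: "translate v (S \<inter> T) = translate v S \<inter> translate v T"
  unfolding translate_def by (rule image_Int) (simp add: inj_def)

lemma dilate_Int: "c \<noteq> 0 \<Longrightarrow> dilate c (S \<inter> T) = dilate c S \<inter> dilate c T"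
  unfolding dilate_def by (rule image_Int) (simp add: inj_def)

lemma interior_translate: "interior (translate v T) = translate v (interior T)"
  unfolding translate_def by (rule interior_translation)

lemma frontier_translate: "frontier (translate v T) = translate v (frontier T)"
  unfolding translate_def by (rule frontier_translation)

lemma interior_dilate: "c \<noteq> 0 \<Longrightarrow> interior (dilate c T) = dilate c (interior T)"
  unfolding dilate_def
  by (rule interior_injective_linear_image) (auto simp: inj_def intro: bounded_linear.linear[OF bounded_linear_scaleR_right])

lemma closure_dilate: "closure (dilate c T) = dilate c (closure T)"
  unfolding dilate_def by (rule closure_scaleR[symmetric])

lemma frontier_dilate: "c \<noteq> 0 \<Longrightarrow> frontier (dilate c T) = dilate c (frontier T)"
  unfolding frontier_def closure_dilate interior_dilate
  unfolding dilate_def by (rule image_set_diff[symmetric]) (simp add: inj_def)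

lemma measure_translate [simp]: "measure lebesgue (translate v T) = measure lebesgue T"
  unfolding translate_def by (rule measure_translation)

lemma measure_dilate:
  fixes T :: "(real ^ 'd) set"
  shows "measure lebesgue (dilate c T) = \<bar>c\<bar> ^ CARD('d) * measure lebesgue T"
  using measure_lebesgue_affine[of c 0 T] by (simp add: dilate_def)

text \<open>The point of \<open>T\<close> that is farthest in direction \<open>u\<close> cannot be moved by \<open>u\<close> within \<open>T\<close>.\<close>
lemma translate_eq_self_imp_zero:
  fixes T :: "(real ^ 'd) set"
  assumes "compact T" "T \<noteq> {}" "translate u T = T"
  shows "u = 0"
proof -
  have "continuous_on T (\<lambda>x. inner x u)" by (intro continuous_intros)
  then obtain x where x: "x \<in> T" "\<forall>y\<in>T. inner y u \<le> inner x u"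
    using continuous_attains_sup[OF assms(1,2)] by blast
  have "u + x \<in> T" using x(1) assms(3) by (auto simp: translate_def)
  then have "inner (u + x) u \<le> inner x u" using x(2) by blast
  then have "inner u u \<le> 0" by (simp add: inner_add_left)
  then have "inner u u = 0" using inner_ge_zero[of u] by linarith
  then show ?thesis by simp
qed

section \<open>Volume, packing and isometries\<close>

lemma negligible_Int_of_disjoint_interiors:
  assumes "interior S \<inter> interior T = {}" "closed S" "closed T"
    and "negligible (frontier S)" "negligible (frontier T)"
  shows "negligible (S \<inter> T)"
proof (rule negligible_subset)
  show "negligible (frontier S \<union> frontier T)" using assms by (simp add: negligible_Un)
  show "S \<inter> T \<subseteq> frontier S \<union> frontier T" using assms by (auto simp: frontier_def)
qed

lemma sum_measure_interior_le:
  fixes P :: "'a::euclidean_space set set"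
  assumes "finite P" "pairwise (\<lambda>S T. interior S \<inter> interior T = {}) P"
    and "\<And>T. T \<in> P \<Longrightarrow> interior T \<in> lmeasurable" "\<And>T. T \<in> P \<Longrightarrow> interior T \<subseteq> U" "U \<in> lmeasurable"
  shows "(\<Sum>T\<in>P. measure lebesgue (interior T)) \<le> measure lebesgue U"
proof -
  have "(\<Sum>T\<in>P. measure lebesgue (interior T)) = measure lebesgue (\<Union>(interior ` P))"
    using assms(1-3)
    by (intro measure_negligible_finite_Union_image[symmetric]) (auto simp: pairwise_def)
  also have "\<dots> \<le> measure lebesgue U"
    using assms by (intro measure_mono_fmeasurable) (auto intro!: fmeasurable.finite_UN fmeasurableD)
  finally show ?thesis .
qed

lemma packing_bound:
  fixes P :: "'a::euclidean_space set set" and c :: real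
  assumes P: "pairwise (\<lambda>S T. interior S \<inter> interior T = {}) P"
    and big: "\<And>T. T \<in> P \<Longrightarrow> c \<le> measure lebesgue (interior T)" and c: "0 < c"
    and U: "\<And>T. T \<in> P \<Longrightarrow> interior T \<subseteq> U" "bounded U" "U \<in> lmeasurable"
  shows "finite P \<and> card P * c \<le> measure lebesgue U"
proof -
  have *: "card F * c \<le> measure lebesgue U" if F: "F \<subseteq> P" "finite F" for F
  proof -
    have "card F * c \<le> (\<Sum>T\<in>F. measure lebesgue (interior T))"
      using F big sum_bounded_below[of F c "\<lambda>T. measure lebesgue (interior T)"] by auto
    also have "\<dots> \<le> measure lebesgue U"
    proof (rule sum_measure_interior_le)
      show "pairwise (\<lambda>S T. interior S \<inter> interior T = {}) F" using P F pairwise_subset by blast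
      show "interior T \<in> lmeasurable" if "T \<in> F" for T
        using U that F by (meson bounded_subset lmeasurable_open open_interior subsetD)
    qed (use F U in auto)
    finally show ?thesis .
  qed
  have "finite P \<and> card P \<le> nat \<lfloor>measure lebesgue U / c\<rfloor>"
  proof (rule finite_if_finite_subsets_card_bdd)
    fix F assume "F \<subseteq> P" "finite F"
    then have "real (card F) \<le> measure lebesgue U / c" using * c by (simp add: pos_le_divide_eq)
    then show "card F \<le> nat \<lfloor>measure lebesgue U / c\<rfloor>" by (simp add: le_nat_floor)
  qed
  then show ?thesis using * by blast
qed

lemma isometry_image_ball:
  fixes f :: "'a::euclidean_space \<Rightarrow> 'a"
  assumes f: "\<And>x y. dist (f x) (f y) = dist x y"
  shows "f ` ball a r = ball (f a) r" "surj f"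
proof -
  define g where "g x = f x - f 0" for x
  have "orthogonal_transformation g"
    unfolding orthogonal_transformation_isometry g_def using f by (simp add: dist_norm)
  then have "surj g" by (rule orthogonal_transformation_surj)
  show sf: "surj f"
  proof (rule surjI)
    show "f (inv_into UNIV g (y - f 0)) = y" for y
      using surj_f_inv_f[OF \<open>surj g\<close>, of "y - f 0"] by (simp add: g_def)
  qed
  show "f ` ball a r = ball (f a) r"
  proof
    show "f ` ball a r \<subseteq> ball (f a) r" using f by auto
    show "ball (f a) r \<subseteq> f ` ball a r"
    proof
      fix y assume y: "y \<in> ball (f a) r"
      obtain x where "y = f x" using sf by blast
      then show "y \<in> f ` ball a r" using y f by auto
    qed
  qed
qed

lemma lebesgue_open: "open U \<Longrightarrow> U \<in> sets lebesgue"
  by auto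

text \<open>By Vitali's covering theorem \<open>U\<close> is a disjoint union of balls up to a null set, and an isometry maps
  balls to balls of the same radius.  The image of the null set can be neglected because only one
  inequality is claimed; the other one follows by applying it to the inverse isometry.\<close>
lemma isometry_emeasure_open:
  fixes f :: "'a::euclidean_space \<Rightarrow> 'a"
  assumes f: "\<And>x y. dist (f x) (f y) = dist x y" and U: "open U"
  shows "open (f ` U) \<and> emeasure lebesgue U \<le> emeasure lebesgue (f ` U)"
proof -
  have inj: "inj f" by (rule injI) (metis f dist_eq_0_iff)
  have opn: "open (f ` U)"
    unfolding open_contains_ball
  proof
    fix y assume "y \<in> f ` U"
    then obtain x where x: "x \<in> U" "y = f x" by blast
    then obtain e where "e > 0" "ball x e \<subseteq> U" using U open_contains_ball by blast
    then have "f ` ball x e \<subseteq> f ` U" by blast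
    then have "ball y e \<subseteq> f ` U" using isometry_image_ball(1)[of f, OF f, of x e] x by simp
    then show "\<exists>e>0. ball y e \<subseteq> f ` U" using \<open>e > 0\<close> by blast
  qed
  define K where "K = {(a, r). r > 0 \<and> ball a r \<subseteq> U}"
  have cover: "\<exists>i. i \<in> K \<and> x \<in> ball (fst i) (snd i) \<and> snd i < d" if "x \<in> U" "0 < d" for x d
  proof -
    obtain e where e: "e > 0" "ball x e \<subseteq> U" using U \<open>x \<in> U\<close> open_contains_ball by blast
    have "ball x (min e (d / 2)) \<subseteq> U" using e by auto
    then show ?thesis using that e by (intro exI[of _ "(x, min e (d / 2))"]) (auto simp: K_def)
  qed
  obtain C where C: "countable C" "C \<subseteq> K"
    "pairwise (\<lambda>i j. disjnt (ball (fst i) (snd i)) (ball (fst j) (snd j))) C"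
    "negligible (U - (\<Union>i\<in>C. ball (fst i) (snd i)))"
    by (rule Vitali_covering_theorem_balls[where S = U and K = K and a = fst and r = snd, OF cover])
  let ?B = "\<lambda>i. ball (fst i) (snd i)"
  have dis: "disjoint_family_on ?B C"
    using C(3) by (auto simp: disjoint_family_on_def pairwise_def disjnt_def)
  have dis': "disjoint_family_on (\<lambda>i. f ` ?B i) C"
    using dis inj by (simp add: disjoint_family_on_def image_Int[symmetric])
  have "emeasure lebesgue U \<le> emeasure lebesgue ((\<Union>i\<in>C. ?B i) \<union> (U - (\<Union>i\<in>C. ?B i)))"
    using U by (intro emeasure_mono sets.Un sets.Diff lebesgue_open open_UN) auto
  also have "\<dots> = emeasure lebesgue (\<Union>i\<in>C. ?B i)"
    using C(4) by (intro emeasure_Un_null_set lebesgue_open open_UN) (auto simp: negligible_iff_null_sets)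
  also have "\<dots> = (\<integral>\<^sup>+i. emeasure lebesgue (?B i) \<partial>count_space C)"
    using C(1) dis by (intro emeasure_UN_countable) auto
  also have "\<dots> = (\<integral>\<^sup>+i. emeasure lebesgue (f ` ?B i) \<partial>count_space C)"
  proof (rule nn_integral_cong)
    fix i assume "i \<in> space (count_space C)"
    then have "snd i \<ge> 0" using C(2) by (auto simp: K_def)
    then show "emeasure lebesgue (?B i) = emeasure lebesgue (f ` ?B i)"
      unfolding isometry_image_ball(1)[of f, OF f] by (metis emeasure_lebesgue_ball_conv_unit_ball)
  qed
  also have "\<dots> = emeasure lebesgue (\<Union>i\<in>C. f ` ?B i)"
    using C(1) dis' by (intro emeasure_UN_countable[symmetric]) (auto simp: isometry_image_ball(1)[of f, OF f])
  also have "\<dots> \<le> emeasure lebesgue (f ` U)"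
  proof (rule emeasure_mono)
    have "?B i \<subseteq> U" if "i \<in> C" for i using C(2) that by (force simp: K_def)
    then show "(\<Union>i\<in>C. f ` ?B i) \<subseteq> f ` U" by blast
  qed (use opn in auto)
  finally show ?thesis using opn by blast
qed

lemma measure_interior_eq:
  assumes "compact S" "negligible (frontier S)"
  shows "measure lebesgue (interior S) = measure lebesgue S"
  using assms compact_imp_closed[of S] interior_subset[of S]
  by (intro measure_negligible_symdiff) (auto simp: frontier_def lmeasurable_compact Diff_eq_empty_iff[THEN iffD2])

lemma isometry_measure_le:
  fixes f :: "'a::euclidean_space \<Rightarrow> 'a"
  assumes f: "\<And>x y. dist (f x) (f y) = dist x y"
    and S: "compact S" "negligible (frontier S)" and fS: "f ` S \<in> lmeasurable"
  shows "measure lebesgue S \<le> measure lebesgue (f ` S)"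
proof -
  note op = isometry_emeasure_open[of f, OF f open_interior, of S]
  have "emeasure lebesgue (interior S) \<le> emeasure lebesgue (f ` S)"
    using op fS by (intro order_trans[OF conjunct2[OF op]] emeasure_mono image_mono interior_subset) auto
  moreover have "interior S \<in> lmeasurable"
    using S by (meson bounded_subset compact_imp_bounded interior_subset lmeasurable_open open_interior)
  ultimately have "measure lebesgue (interior S) \<le> measure lebesgue (f ` S)"
    using fS by (simp add: emeasure_eq_measure2 )
  then show ?thesis using measure_interior_eq[OF S] by simp
qed

lemma isometry_inverse:
  fixes f :: "'a::euclidean_space \<Rightarrow> 'a"
  assumes f: "\<And>x y. dist (f x) (f y) = dist x y"
  obtains g where "\<And>x y. dist (g x) (g y) = dist x y" "\<And>x. g (f x) = x" "\<And>x. f (g x) = x"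
proof -
  have "inj f" by (rule injI) (metis f dist_eq_0_iff)
  moreover have "surj f" using isometry_image_ball(2)[of f, OF f] .
  ultimately have *: "f (inv_into UNIV f x) = x" "inv_into UNIV f (f x) = x" for x
    by (auto simp: surj_f_inv_f)
  have "dist (inv_into UNIV f x) (inv_into UNIV f y) = dist x y" for x y
    using f[of "inv_into UNIV f x" "inv_into UNIV f y"] * by simp
  then show ?thesis using that[of "inv_into UNIV f"] * by blast
qed

section \<open>Inflation of clusters of tiles\<close>

(* Volumes are kept in the form "measure lebesgue", which this rule would change for Borel sets only. *)
declare measure_completion [simp del]

lemma translate_empty [simp]: "translate v {} = {}" and dilate_empty [simp]: "dilate c {} = {}"
  by (simp_all add: translate_def dilate_def)

lemma disjoint_interiors_translate:
  assumes "pairwise (\<lambda>S T. interior S \<inter> interior T = {}) P"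
  shows "pairwise (\<lambda>S T. interior S \<inter> interior T = {}) (translate v ` P)"
proof (rule pairwiseI)
  fix A B assume "A \<in> translate v ` P" "B \<in> translate v ` P" "A \<noteq> B"
  then obtain S T where *: "S \<in> P" "T \<in> P" "S \<noteq> T" "A = translate v S" "B = translate v T" by blast
  then have "interior S \<inter> interior T = {}" using assms by (auto simp: pairwise_def)
  then show "interior A \<inter> interior B = {}"
    using * by (simp add: interior_translate translate_Int[symmetric])
qed

lemma disjoint_interiors_dilate:
  assumes "pairwise (\<lambda>S T. interior S \<inter> interior T = {}) P" and c: "c \<noteq> 0"
  shows "pairwise (\<lambda>S T. interior S \<inter> interior T = {}) (dilate c ` P)"
proof (rule pairwiseI)
  fix A B assume "A \<in> dilate c ` P" "B \<in> dilate c ` P" "A \<noteq> B"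
  then obtain S T where *: "S \<in> P" "T \<in> P" "S \<noteq> T" "A = dilate c S" "B = dilate c T" by blast
  then have "interior S \<inter> interior T = {}" using assms by (auto simp: pairwise_def)
  then show "interior A \<inter> interior B = {}"
    using * c by (simp add: interior_dilate dilate_Int[symmetric])
qed

locale tile_substitution =
  fixes \<xi> :: real and Ss :: "(real ^ 'd) set list"
    and H :: "(real ^ 'd) set \<Rightarrow> (real ^ 'd) set set"
  assumes substitution: "substitution \<xi> Ss H"
begin

abbreviation infl :: "(real ^ 'd) set set \<Rightarrow> (real ^ 'd) set set" where
  "infl \<equiv> inflate_subst \<xi> Ss H"

definition copies :: "(real ^ 'd) set set" where
  "copies = {translate v S |v S. S \<in> set Ss}"

definition cluster :: "(real ^ 'd) set set \<Rightarrow> bool" where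
  "cluster P \<longleftrightarrow> finite P \<and> P \<subseteq> copies \<and> pairwise (\<lambda>S T. interior S \<inter> interior T = {}) P"

definition min_volume :: real where
  "min_volume = Min ((\<lambda>S. measure lebesgue (interior S)) ` set Ss)"

definition max_diameter :: real where
  "max_diameter = Max (diameter ` set Ss)"

lemma xi: "1 < \<xi>" and Ss: "Ss \<noteq> []"
  using substitution by (auto simp: substitution_def)

lemma prototile_tile: "S \<in> set Ss \<Longrightarrow> tile S"
  using substitution by (auto simp: substitution_def)

lemma prototile_copy: "S \<in> set Ss \<Longrightarrow> S \<in> copies"
  unfolding copies_def by (metis (mono_tags, lifting) mem_Collect_eq translate_0)

lemma copyE:
  assumes "T \<in> copies" obtains v S where "S \<in> set Ss" "T = translate v S"
  using assms by (auto simp: copies_def)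

lemma translate_copy: "T \<in> copies \<Longrightarrow> translate v T \<in> copies"
  by (force simp: copies_def)

lemma copy_tile: "T \<in> copies \<Longrightarrow> tile T"
  by (auto elim!: copyE intro: tile_translate prototile_tile)

lemma copy_compact: "T \<in> copies \<Longrightarrow> compact T"
  using copy_tile tile_compact by blast

lemma copy_lmeasurable: "T \<in> copies \<Longrightarrow> T \<in> lmeasurable" "T \<in> copies \<Longrightarrow> interior T \<in> lmeasurable"
  using copy_compact
  by (auto simp: lmeasurable_compact intro!: lmeasurable_open bounded_subset[OF compact_imp_bounded interior_subset])

lemma min_volume: "0 < min_volume" "T \<in> copies \<Longrightarrow> min_volume \<le> measure lebesgue (interior T)"
proof -
  have "0 < measure lebesgue (interior S)" if "S \<in> set Ss" for S
  proof -
    have "\<not> negligible (interior S)"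
      using open_not_negligible[OF open_interior] tile_interior_nonempty prototile_tile that by blast
    then show ?thesis
      using copy_lmeasurable(2)[OF prototile_copy[OF that]]
      by (metis measure_nonneg negligible_iff_measure less_eq_real_def)
  qed
  then show "0 < min_volume" using Ss by (simp add: min_volume_def)
  show "min_volume \<le> measure lebesgue (interior T)" if "T \<in> copies"
    using that by (auto elim!: copyE simp: min_volume_def interior_translate)
qed

lemma dist_le_max_diameter:
  assumes "T \<in> copies" "x \<in> T" "y \<in> T"
  shows "dist x y \<le> max_diameter"
proof -
  obtain v S where S: "S \<in> set Ss" "T = translate v S" using assms by (auto elim: copyE)
  then obtain x' y' where *: "x' \<in> S" "x = v + x'" "y' \<in> S" "y = v + y'"
    using assms by (auto simp: translate_def)
  have "dist x' y' \<le> diameter S"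
    using S * prototile_tile tile_compact compact_imp_bounded diameter_bounded_bound by blast
  also have "\<dots> \<le> max_diameter" using S by (simp add: max_diameter_def)
  finally show ?thesis using * by (simp add: dist_norm)
qed

lemma max_diameter_nonneg: "0 \<le> max_diameter"
proof -
  obtain S where S: "S \<in> set Ss" using Ss by (cases Ss) auto
  obtain x where "x \<in> S" using tile_nonempty[OF prototile_tile[OF S]] by blast
  then show ?thesis using dist_le_max_diameter[of S x x] S prototile_copy by simp
qed

text \<open>Distinct prototiles are not translates of each other, and a compact nonempty set is not a nontrivial
  translate of itself.  Hence the only substitute of the tile \<open>v + S\<close> is \<open>v + H(S)\<close>.\<close>
lemma copy_unique:
  assumes "S \<in> set Ss" "S' \<in> set Ss" "translate v S = translate v' S'"
  shows "S = S' \<and> v = v'"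
proof -
  have "translate (- v) (translate v S) = translate (- v) (translate v' S')" using assms(3) by simp
  then have *: "S = translate (v' - v) S'" by simp
  then have "translation_equiv S S'" unfolding translation_equiv_def by blast
  then have SS': "S = S'"
    using substitution assms(1,2) unfolding substitution_def by (metis in_set_conv_nth)
  then have "v' - v = 0"
    using * assms(2) prototile_tile tile_compact tile_nonempty translate_eq_self_imp_zero by metis
  then show ?thesis using SS' by simp
qed

lemma subst_tile_copy:
  assumes "S \<in> set Ss" shows "subst_tile Ss H (translate v S) = translate v ` H S"
proof -
  have "subst_tile Ss H (translate v S)
      = {translate v' T' |v' S' T'. S' = S \<and> v' = v \<and> T' \<in> H S}"
    unfolding subst_tile_def using assms copy_unique by blast
  then show ?thesis by blast
qed

lemma subst_tile_translate: "subst_tile Ss H (translate v T) = translate v ` subst_tile Ss H T"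
proof -
  have eq: "translate v T = translate u S \<longleftrightarrow> T = translate (u - v) S" for u S
  proof
    assume "translate v T = translate u S"
    then have "translate (- v) (translate v T) = translate (- v) (translate u S)" by simp
    then show "T = translate (u - v) S" by simp
  qed simp
  show ?thesis
  proof (intro equalityI subsetI)
    fix X assume "X \<in> subst_tile Ss H (translate v T)"
    then obtain u S T' where *: "X = translate u T'" "S \<in> set Ss" "T = translate (u - v) S" "T' \<in> H S"
      unfolding subst_tile_def eq by blast
    then have "translate (u - v) T' \<in> subst_tile Ss H T" unfolding subst_tile_def by blast
    moreover have "X = translate v (translate (u - v) T')" using * by simp
    ultimately show "X \<in> translate v ` subst_tile Ss H T" by blast
  next
    fix X assume "X \<in> translate v ` subst_tile Ss H T"
    then obtain u S T' where *: "X = translate v (translate u T')" "S \<in> set Ss" "T = translate u S" "T' \<in> H S"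
      unfolding subst_tile_def by blast
    then show "X \<in> subst_tile Ss H (translate v T)"
      unfolding subst_tile_def by (intro CollectI exI[of _ "v + u"] exI[of _ S] exI[of _ T']) auto
  qed
qed

lemma infl_translate: "infl (translate v ` P) = translate (\<xi> *\<^sub>R v) ` infl P"
  unfolding inflate_subst_def image_UN UN_simps(10) subst_tile_translate
  by (simp add: image_image dilate_translate)

lemma infl_UN: "infl (\<Union>i\<in>I. F i) = (\<Union>i\<in>I. infl (F i))"
  unfolding inflate_subst_def by blast

lemma infl_power_UN: "(infl ^^ m) (\<Union>i\<in>I. F i) = (\<Union>i\<in>I. (infl ^^ m) (F i))"
  by (induction m) (simp_all add: infl_UN)

lemma infl_power_eq_UN: "(infl ^^ m) P = (\<Union>T\<in>P. (infl ^^ m) {T})"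
  using infl_power_UN[of m "\<lambda>T. {T}" P] by simp

lemma infl_power_translate: "(infl ^^ m) (translate v ` P) = translate (\<xi> ^ m *\<^sub>R v) ` (infl ^^ m) P"
  by (induction m) (simp_all add: infl_translate)

lemma infl_prototile: "S \<in> set Ss \<Longrightarrow> infl {S} = dilate \<xi> ` H S"
  using subst_tile_copy[of S 0] by (simp add: inflate_subst_def)

lemma cluster_translate: "cluster P \<Longrightarrow> cluster (translate v ` P)"
  unfolding cluster_def using disjoint_interiors_translate translate_copy by auto

lemma cluster_infl_prototile:
  assumes S: "S \<in> set Ss"
  shows "cluster (infl {S})" "\<Union>(infl {S}) = dilate \<xi> S"
proof -
  have H: "patch (H S)" "\<Union>(H S) = S"
    and HT: "\<And>T. T \<in> H S \<Longrightarrow> \<exists>S'\<in>set Ss. translation_equiv T (dilate (1 / \<xi>) S')"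
    using substitution S unfolding substitution_def by blast+
  have dis: "pairwise (\<lambda>S T. interior S \<inter> interior T = {}) (H S)"
    using H by (auto simp: patch_def tiling_of_def)
  have copies: "dilate \<xi> T \<in> copies" if T: "T \<in> H S" for T
  proof -
    obtain S' v where "S' \<in> set Ss" "T = translate v (dilate (1 / \<xi>) S')"
      using HT[OF T] by (auto simp: translation_equiv_def)
    then have "dilate \<xi> T = translate (\<xi> *\<^sub>R v) S'" using xi by (simp add: dilate_translate)
    then show ?thesis using \<open>S' \<in> set Ss\<close> by (auto simp: copies_def)
  qed
  have "finite (H S) \<and> card (H S) * (min_volume / \<xi> ^ CARD('d)) \<le> measure lebesgue S"
  proof (rule packing_bound[OF dis])
    show "min_volume / \<xi> ^ CARD('d) \<le> measure lebesgue (interior T)" if "T \<in> H S" for T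
    proof -
      have "min_volume \<le> measure lebesgue (interior (dilate \<xi> T))"
        using min_volume(2)[OF copies[OF that]] .
      also have "\<dots> = \<xi> ^ CARD('d) * measure lebesgue (interior T)"
        using xi by (simp add: interior_dilate measure_dilate)
      finally show ?thesis using xi by (simp add: divide_le_eq mult.commute)
    qed
    show "0 < min_volume / \<xi> ^ CARD('d)" using min_volume xi by simp
    show "interior T \<subseteq> S" if "T \<in> H S" for T using that H interior_subset by blast
    have "compact S" using S prototile_tile tile_compact by blast
    then show "bounded S" "S \<in> lmeasurable" by (auto simp: compact_imp_bounded lmeasurable_compact)
  qed
  moreover have "pairwise (\<lambda>S T. interior S \<inter> interior T = {}) (dilate \<xi> ` H S)"
    using dis xi by (intro disjoint_interiors_dilate) auto
  ultimately show "cluster (infl {S})"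
    unfolding cluster_def infl_prototile[OF S] using copies by auto
  show "\<Union>(infl {S}) = dilate \<xi> S"
    unfolding infl_prototile[OF S] using H(2) by (auto simp: dilate_def)
qed

lemma cluster_infl_copy:
  assumes "T \<in> copies" shows "cluster (infl {T})" "\<Union>(infl {T}) = dilate \<xi> T"
proof -
  obtain v S where S: "S \<in> set Ss" "T = translate v S" using assms by (auto elim: copyE)
  have *: "infl {T} = translate (\<xi> *\<^sub>R v) ` infl {S}" using infl_translate[of v "{S}"] S by simp
  show "cluster (infl {T})" unfolding * by (intro cluster_translate cluster_infl_prototile S)
  have "\<Union>(translate w ` P) = translate w (\<Union>P)" for w :: "real ^ 'd" and P by (auto simp: translate_def)
  then show "\<Union>(infl {T}) = dilate \<xi> T"
    unfolding * using cluster_infl_prototile(2)[OF S(1)] S(2) by (simp add: dilate_translate)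
qed

lemma cluster_infl:
  assumes "cluster P" shows "cluster (infl P)" "\<Union>(infl P) = dilate \<xi> (\<Union>P)"
proof -
  have P: "finite P" "P \<subseteq> copies" "pairwise (\<lambda>S T. interior S \<inter> interior T = {}) P"
    using assms by (auto simp: cluster_def)
  have eq: "infl P = (\<Union>T\<in>P. infl {T})" using infl_power_eq_UN[of 1 P] by simp
  have child: "cluster (infl {T})" "\<Union>(infl {T}) = dilate \<xi> T" if "T \<in> P" for T
    using cluster_infl_copy that P by blast+
  show un: "\<Union>(infl P) = dilate \<xi> (\<Union>P)"
  proof -
    have "\<Union>(infl P) = (\<Union>T\<in>P. \<Union>(infl {T}))" unfolding eq by blast
    also have "\<dots> = (\<Union>T\<in>P. dilate \<xi> T)" using child(2) by simp
    also have "\<dots> = dilate \<xi> (\<Union>P)" unfolding dilate_def by blast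
    finally show ?thesis .
  qed
  have "interior A \<inter> interior B = {}"
    if A: "A \<in> infl {S}" "S \<in> P" and B: "B \<in> infl {T}" "T \<in> P" and ne: "A \<noteq> B" for A B S T
  proof (cases "S = T")
    case True
    then show ?thesis using child(1)[OF A(2)] A B ne by (auto simp: cluster_def pairwise_def)
  next
    case False
    have "interior A \<subseteq> interior (dilate \<xi> S)" "interior B \<subseteq> interior (dilate \<xi> T)"
      using child(2) A B by (auto intro!: interior_mono)
    moreover have "interior (dilate \<xi> S) \<inter> interior (dilate \<xi> T) = {}"
      using xi False A B P(3) by (simp add: interior_dilate dilate_Int[symmetric] pairwise_def)
    ultimately show ?thesis by blast
  qed
  then have "pairwise (\<lambda>S T. interior S \<inter> interior T = {}) (infl P)"
    unfolding eq pairwise_def by blast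
  moreover have "finite (infl P)" "infl P \<subseteq> copies"
    unfolding eq using P(1) child(1) by (auto simp: cluster_def)
  ultimately show "cluster (infl P)" by (simp add: cluster_def)
qed

lemma cluster_infl_power:
  assumes "cluster P" shows "cluster ((infl ^^ m) P) \<and> \<Union>((infl ^^ m) P) = dilate (\<xi> ^ m) (\<Union>P)"
  using assms by (induction m) (simp_all add: cluster_infl)

lemma supertile:
  assumes "T \<in> copies"
  shows "cluster ((infl ^^ m) {T})" "\<Union>((infl ^^ m) {T}) = dilate (\<xi> ^ m) T"
  using cluster_infl_power[of "{T}" m] assms by (auto simp: cluster_def)

lemma supertile_Suc: "(infl ^^ Suc m) {T} = (\<Union>T'\<in>infl {T}. (infl ^^ m) {T'})"
  unfolding funpow_Suc_right comp_def by (rule infl_power_eq_UN)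

lemma supertiles_disjoint:
  assumes "cluster P" "S \<in> P" "T \<in> P" "S \<noteq> T"
  shows "(infl ^^ m) {S} \<inter> (infl ^^ m) {T} = {}"
proof (rule ccontr)
  assume "(infl ^^ m) {S} \<inter> (infl ^^ m) {T} \<noteq> {}"
  then obtain A where A: "A \<in> (infl ^^ m) {S}" "A \<in> (infl ^^ m) {T}" by blast
  have ST: "S \<in> copies" "T \<in> copies" "interior S \<inter> interior T = {}"
    using assms by (auto simp: cluster_def pairwise_def)
  have "A \<subseteq> dilate (\<xi> ^ m) S" "A \<subseteq> dilate (\<xi> ^ m) T" using A supertile(2) ST by blast+
  then have "interior A \<subseteq> interior (dilate (\<xi> ^ m) S) \<inter> interior (dilate (\<xi> ^ m) T)"
    by (simp add: interior_mono)
  also have "\<dots> = {}"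
    using ST(3) xi by (simp add: interior_dilate dilate_Int[symmetric])
  finally have "interior A = {}" by blast
  moreover have "A \<in> copies" using A(1) supertile(1)[OF ST(1)] by (auto simp: cluster_def)
  ultimately show False using copy_tile tile_interior_nonempty by blast
qed

lemma lmeasurable_frontier_copy:
  assumes "T \<in> copies" 
  shows "frontier T \<in> lmeasurable"
  using assms copy_compact by (simp add: lmeasurable_compact compact_frontier)

text \<open>Inflation magnifies a ball inside \<open>S\<close> by \<open>\<xi>\<^sup>n\<close>, while the tiles of the inflated patch keep their
  diameters.  So eventually the tile covering the centre of the ball fits inside.\<close>
lemma interior_subtile:
  assumes S: "S \<in> copies"
  obtains n T where "T \<in> (infl ^^ n) {S}" "T \<subseteq> interior (dilate (\<xi> ^ n) S)"
proof -
  obtain p r where r: "r > 0" "ball p r \<subseteq> interior S"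
    using tile_interior_nonempty[OF copy_tile[OF S]] open_interior[of S] unfolding open_contains_ball by blast
  obtain n where n: "max_diameter / r < \<xi> ^ n" using real_arch_pow[OF xi] by blast
  have pos: "0 < \<xi> ^ n" using xi by simp
  have "p \<in> S" using r interior_subset by force
  then have "\<xi> ^ n *\<^sub>R p \<in> \<Union>((infl ^^ n) {S})" unfolding supertile(2)[OF S] dilate_def by (rule imageI)
  then obtain T where T: "T \<in> (infl ^^ n) {S}" "\<xi> ^ n *\<^sub>R p \<in> T" by blast
  have "T \<in> copies" using T supertile(1)[OF S] by (auto simp: cluster_def)
  have "T \<subseteq> dilate (\<xi> ^ n) (interior S)"
  proof
    fix x assume "x \<in> T"
    have "dist (\<xi> ^ n *\<^sub>R p) x \<le> max_diameter"
      using dist_le_max_diameter[OF \<open>T \<in> copies\<close> T(2) \<open>x \<in> T\<close>] .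
    also have "\<dots> < r * \<xi> ^ n" using n r by (simp add: divide_less_eq mult.commute)
    finally have near: "dist (\<xi> ^ n *\<^sub>R p) x < r * \<xi> ^ n" .
    have "x = \<xi> ^ n *\<^sub>R ((1 / \<xi> ^ n) *\<^sub>R x)" using xi by simp
    have "dist p ((1 / \<xi> ^ n) *\<^sub>R x) = dist (\<xi> ^ n *\<^sub>R p) x / \<xi> ^ n"
    proof -
      have "p - (1 / \<xi> ^ n) *\<^sub>R x = (1 / \<xi> ^ n) *\<^sub>R (\<xi> ^ n *\<^sub>R p - x)"
        using xi by (simp add: scaleR_diff_right)
      then show ?thesis using pos by (simp add: dist_norm)
    qed
    then have "dist p ((1 / \<xi> ^ n) *\<^sub>R x) < r" using near pos by (simp add: divide_less_eq)
    then have "(1 / \<xi> ^ n) *\<^sub>R x \<in> interior S" using r by auto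
    then show "x \<in> dilate (\<xi> ^ n) (interior S)"
      unfolding dilate_def using \<open>x = \<xi> ^ n *\<^sub>R ((1 / \<xi> ^ n) *\<^sub>R x)\<close> by blast
  qed
  then have "T \<subseteq> interior (dilate (\<xi> ^ n) S)" using xi by (simp add: interior_dilate)
  with T(1) show ?thesis by (rule that)
qed

text \<open>Let \<open>S\<close> maximise the ratio \<open>t\<close> of the volumes of boundary and interior.  The boundary of the inflated
  \<open>S\<close> is covered by the boundaries of its tiles, and the tile \<open>T0\<close> lying in the interior can be left
  out.  The volume of this cover is at most \<open>t\<close> times the total volume of the interiors other than
  that of \<open>T0\<close>, but the boundary it covers has volume \<open>t\<close> times that of the whole interior.  This
  is possible only if \<open>t = 0\<close>.\<close>
lemma negligible_frontier_copy:
  assumes "T \<in> copies" shows "negligible (frontier T)"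
proof -
  let ?\<mu> = "measure lebesgue"
  define ratio where "ratio S = ?\<mu> (frontier S) / ?\<mu> (interior S)" for S :: "(real ^ 'd) set"
  define t where "t = Max (ratio ` set Ss)"
  have ipos: "0 < ?\<mu> (interior S)" if "S \<in> copies" for S using min_volume that by force
  have "ratio S \<le> t" if "S \<in> set Ss" for S using that by (simp add: t_def)
  then have t_proto: "?\<mu> (frontier S) \<le> t * ?\<mu> (interior S)" if "S \<in> set Ss" for S
    using that ipos[OF prototile_copy[OF that]] by (simp add: ratio_def divide_le_eq)
  have t_copy: "?\<mu> (frontier S) \<le> t * ?\<mu> (interior S)" if "S \<in> copies" for S
    using that t_proto by (auto elim!: copyE simp: frontier_translate interior_translate)
  have "t \<in> ratio ` set Ss" unfolding t_def using Ss by (intro Max_in) auto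
  then obtain S where S: "S \<in> set Ss" "ratio S = t" by blast
  then have S_eq: "?\<mu> (frontier S) = t * ?\<mu> (interior S)"
    using ipos[OF prototile_copy[OF S(1)]] by (auto simp: ratio_def)
  have Sc: "S \<in> copies" using S prototile_copy by blast
  have "0 \<le> t" using S ipos[OF Sc] by (auto simp: ratio_def)
  obtain n T0 where T0: "T0 \<in> (infl ^^ n) {S}" "T0 \<subseteq> interior (dilate (\<xi> ^ n) S)"
    by (rule interior_subtile[OF Sc])
  let ?W = "(infl ^^ n) {S}" and ?D = "dilate (\<xi> ^ n) S"
  have W: "finite ?W" "?W \<subseteq> copies" "pairwise (\<lambda>S T. interior S \<inter> interior T = {}) ?W"
    using supertile(1)[OF Sc] by (auto simp: cluster_def)
  have D: "\<Union>?W = ?D" by (rule supertile(2)[OF Sc])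
  have cD: "compact ?D" unfolding dilate_def using copy_compact[OF Sc] by (rule compact_scaling)
  have fr: "frontier ?D \<subseteq> (\<Union>T\<in>?W - {T0}. frontier T)"
  proof
    fix x assume x: "x \<in> frontier ?D"
    then have "x \<in> ?D" "x \<notin> interior ?D" using compact_imp_closed[OF cD] by (auto simp: frontier_def)
    then obtain T where T: "T \<in> ?W" "x \<in> T" using D by blast
    have "T \<noteq> T0" using T0 T \<open>x \<notin> interior ?D\<close> by blast
    moreover have "interior T \<subseteq> interior ?D" using T D by (intro interior_mono) blast
    moreover have "x \<in> frontier T"
      using T(2) closure_subset[of T] \<open>x \<notin> interior ?D\<close> calculation(2) unfolding frontier_def by blast
    ultimately show "x \<in> (\<Union>T\<in>?W - {T0}. frontier T)" using T(1) by blast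
  qed
  have "t * ?\<mu> (interior ?D) = ?\<mu> (frontier ?D)"
    using S_eq xi by (simp add: interior_dilate frontier_dilate measure_dilate)
  also have "\<dots> \<le> ?\<mu> (\<Union>T\<in>?W - {T0}. frontier T)"
  proof (rule measure_mono_fmeasurable[OF fr])
    show "frontier ?D \<in> sets lebesgue" using compact_frontier[OF cD] lmeasurable_compact fmeasurableD by blast
    show "(\<Union>T\<in>?W - {T0}. frontier T) \<in> lmeasurable"
      using W lmeasurable_frontier_copy by (intro fmeasurable.finite_UN) auto
  qed
  also have "\<dots> \<le> (\<Sum>T\<in>?W - {T0}. ?\<mu> (frontier T))"
    using W lmeasurable_frontier_copy by (intro measure_UNION_le) (auto dest: fmeasurableD)
  also have "\<dots> \<le> (\<Sum>T\<in>?W - {T0}. t * ?\<mu> (interior T))"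
    using W t_copy by (intro sum_mono) auto
  also have "\<dots> = t * ((\<Sum>T\<in>?W. ?\<mu> (interior T)) - ?\<mu> (interior T0))"
    using W T0 by (simp add: sum_diff1 sum_distrib_left[symmetric])
  also have "\<dots> \<le> t * (?\<mu> (interior ?D) - ?\<mu> (interior T0))"
  proof (intro mult_left_mono diff_right_mono sum_measure_interior_le W \<open>0 \<le> t\<close>)
    show "interior T \<in> lmeasurable" if "T \<in> ?W" for T using that W copy_lmeasurable by blast
    show "interior T \<subseteq> interior ?D" if "T \<in> ?W" for T using that D by (intro interior_mono) blast
    show "interior ?D \<in> lmeasurable"
      using cD by (meson bounded_subset compact_imp_bounded interior_subset lmeasurable_open open_interior)
  qed
  finally have "t * ?\<mu> (interior T0) \<le> 0" by (simp add: algebra_simps)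
  moreover have "0 < ?\<mu> (interior T0)" using ipos T0 W by blast
  ultimately have "t = 0" using \<open>0 \<le> t\<close> by (simp add: mult_le_0_iff)
  then have "?\<mu> (frontier T) = 0" using t_copy[OF assms] by (simp add: measure_le_0_iff)
  then show ?thesis using lmeasurable_frontier_copy[OF assms] by (simp add: negligible_iff_measure)
qed

lemma measure_Int_cluster:
  assumes P: "cluster P" and G: "G \<in> sets lebesgue"
  shows "measure lebesgue (G \<inter> \<Union>P) = (\<Sum>T\<in>P. measure lebesgue (G \<inter> T))"
proof -
  have eq: "G \<inter> \<Union>P = (\<Union>T\<in>P. G \<inter> T)" by blast
  show ?thesis
    unfolding eq
  proof (rule measure_negligible_finite_Union_image)
    show "finite P" using P by (simp add: cluster_def)
    show "G \<inter> T \<in> lmeasurable" if "T \<in> P" for T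
      using that P G copy_lmeasurable(1)
      by (subst Int_commute, intro fmeasurable_Int_fmeasurable) (auto simp: cluster_def)
    show "pairwise (\<lambda>S T. negligible ((G \<inter> S) \<inter> (G \<inter> T))) P"
    proof (rule pairwiseI)
      fix S T assume ST: "S \<in> P" "T \<in> P" "S \<noteq> T"
      have "negligible (S \<inter> T)"
        using P ST copy_compact compact_imp_closed negligible_frontier_copy
        by (intro negligible_Int_of_disjoint_interiors) (auto simp: cluster_def pairwise_def)
      then show "negligible ((G \<inter> S) \<inter> (G \<inter> T))" by (rule negligible_subset) blast
    qed
  qed
qed

end

section \<open>The number of tiles in a supertile\<close>

lemma prototile_equiv_refl: "prototile_equiv H S S"
  unfolding prototile_equiv_def by (intro exI[of _ "\<lambda>x. x"]) auto

lemma prototile_equiv_sym: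
  assumes "prototile_equiv H S S'" shows "prototile_equiv H S' S"
proof -
  obtain f where f: "\<And>x y. dist (f x) (f y) = dist x y" "S = f ` S'" "H S = (\<lambda>T. f ` T) ` H S'"
    using assms unfolding prototile_equiv_def by blast
  obtain g where g: "\<And>x y. dist (g x) (g y) = dist x y" "\<And>x. g (f x) = x"
    using isometry_inverse[of f, OF f(1)] by metis
  have "S' = g ` S" "H S' = (\<lambda>T. g ` T) ` H S" using f g by (simp_all add: image_image)
  then show ?thesis unfolding prototile_equiv_def using g(1) by blast
qed

lemma prototile_equiv_trans:
  assumes "prototile_equiv H S S'" "prototile_equiv H S' S''" shows "prototile_equiv H S S''"
proof -
  obtain f where f: "\<And>x y. dist (f x) (f y) = dist x y" "S = f ` S'" "H S = (\<lambda>T. f ` T) ` H S'"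
    using assms(1) unfolding prototile_equiv_def by blast
  obtain g where g: "\<And>x y. dist (g x) (g y) = dist x y" "S' = g ` S''" "H S' = (\<lambda>T. g ` T) ` H S''"
    using assms(2) unfolding prototile_equiv_def by blast
  have "S = (\<lambda>x. f (g x)) ` S''" "H S = (\<lambda>T. (\<lambda>x. f (g x)) ` T) ` H S''"
    unfolding f(3) g(3) unfolding f(2) g(2) by (simp_all add: image_image)
  then show ?thesis unfolding prototile_equiv_def using f(1) g(1) by (intro exI[of _ "\<lambda>x. f (g x)"]) auto
qed

lemma basic_tiles_exist: "\<exists>Ts. basic_tiles Ss H Ts"
proof -
  define r where "r S = (SOME T. T \<in> set Ss \<and> prototile_equiv H S T)" for S
  have r: "r S \<in> set Ss" "prototile_equiv H S (r S)" if "S \<in> set Ss" for S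
    unfolding r_def using someI_ex[of "\<lambda>T. T \<in> set Ss \<and> prototile_equiv H S T"] that prototile_equiv_refl
    by blast+
  have r_eq: "r S = r S'" if "prototile_equiv H S S'" for S S'
  proof -
    have "prototile_equiv H S T \<longleftrightarrow> prototile_equiv H S' T" for T
      using that prototile_equiv_sym prototile_equiv_trans by blast
    then show ?thesis by (simp add: r_def)
  qed
  have "\<exists>!T. T \<in> set (remdups (map r Ss)) \<and> prototile_equiv H S T" if S: "S \<in> set Ss" for S
  proof (rule ex1I[of _ "r S"])
    show "r S \<in> set (remdups (map r Ss)) \<and> prototile_equiv H S (r S)" using r(2)[OF S] S by simp
    fix T assume "T \<in> set (remdups (map r Ss)) \<and> prototile_equiv H S T"
    then obtain S1 where S1: "S1 \<in> set Ss" "T = r S1" "prototile_equiv H S T" by auto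
    have "prototile_equiv H S S1"
      using S1 r(2)[OF S1(1)] prototile_equiv_sym prototile_equiv_trans by blast
    then show "T = r S" using r_eq S1 by simp
  qed
  then have "basic_tiles Ss H (remdups (map r Ss))"
    unfolding basic_tiles_def using r(1) by auto
  then show ?thesis by blast
qed

lemma basic_tile_of:
  assumes "basic_tiles Ss H Ts" "S \<in> set Ss"
  obtains B where "B \<in> set Ts" "prototile_equiv H S B"
    "\<forall>B'\<in>set Ts. prototile_equiv H S B' \<longrightarrow> B' = B"
proof -
  have "\<exists>!B. B \<in> set Ts \<and> prototile_equiv H S B"
    using assms unfolding basic_tiles_def by simp
  then show ?thesis using that by (elim ex1E) blast
qed

context tile_substitution
begin

lemma measure_prototile_equiv:
  assumes "S \<in> set Ss" "S' \<in> set Ss" "prototile_equiv H S S'"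
  shows "measure lebesgue S = measure lebesgue S'"
proof -
  have le: "measure lebesgue B \<le> measure lebesgue A"
    if AB: "A \<in> set Ss" "B \<in> set Ss" "prototile_equiv H A B" for A B
  proof -
    obtain f where f: "\<And>x y. dist (f x) (f y) = dist x y" "A = f ` B"
      using AB(3) unfolding prototile_equiv_def by blast
    have "A \<in> copies" "B \<in> copies" using AB prototile_copy by blast+
    then show ?thesis
      using isometry_measure_le[of f, OF f(1), of B] copy_compact negligible_frontier_copy copy_lmeasurable(1) f(2)
      by simp
  qed
  show ?thesis using le assms prototile_equiv_sym by (meson order_antisym)
qed

text \<open>A sum over an inflated tile becomes a product with a column of the substitution matrix, for
  quantities that depend only on the class of a tile.\<close>
lemma sum_by_basic_tiles:
  fixes \<phi> :: "(real ^ 'd) set \<Rightarrow> real"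
  assumes Ts: "basic_tiles Ss H Ts" and P: "finite P" "P \<subseteq> copies"
    and trans: "\<And>v T. \<phi> (translate v T) = \<phi> T"
    and equiv: "\<And>S S'. S \<in> set Ss \<Longrightarrow> S' \<in> set Ss \<Longrightarrow> prototile_equiv H S S' \<Longrightarrow> \<phi> S = \<phi> S'"
  shows "(\<Sum>T\<in>P. \<phi> T) = (\<Sum>i<length Ts.
    card {T \<in> P. \<exists>S'\<in>set Ss. prototile_equiv H S' (Ts ! i) \<and> translation_equiv T S'} * \<phi> (Ts ! i))"
proof -
  define Q where "Q i T \<longleftrightarrow> (\<exists>S'\<in>set Ss. prototile_equiv H S' (Ts ! i) \<and> translation_equiv T S')" for i T
  have dec: "\<phi> T = (\<Sum>i<length Ts. if Q i T then \<phi> (Ts ! i) else 0)" if T: "T \<in> P" for T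
  proof -
    obtain v S where S: "S \<in> set Ss" "T = translate v S"
      using T P(2) by (blast elim: copyE)
    obtain B where B: "B \<in> set Ts" "prototile_equiv H S B"
      and uniq: "\<forall>B'\<in>set Ts. prototile_equiv H S B' \<longrightarrow> B' = B"
      by (rule basic_tile_of[OF Ts S(1)])
    obtain k where k: "k < length Ts" "Ts ! k = B" using B(1) by (auto simp: in_set_conv_nth)
    have "Q i T \<longleftrightarrow> i = k" if i: "i < length Ts" for i
    proof
      assume "Q i T"
      then obtain S' u where "S' \<in> set Ss" "prototile_equiv H S' (Ts ! i)" "T = translate u S'"
        unfolding Q_def translation_equiv_def by blast
      then have "prototile_equiv H S (Ts ! i)" using copy_unique[of S S' v u] S by auto
      then have "Ts ! i = B" using uniq i by simp
      then show "i = k" using i k Ts by (metis basic_tiles_def nth_eq_iff_index_eq)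
    next
      assume "i = k"
      then show "Q i T" unfolding Q_def translation_equiv_def using S B k by blast
    qed
    then have "(\<Sum>i<length Ts. if Q i T then \<phi> (Ts ! i) else 0) = (\<Sum>i<length Ts. if i = k then \<phi> (Ts ! i) else 0)"
      by (intro sum.cong) auto
    also have "\<dots> = \<phi> B" using k by simp
    also have "\<dots> = \<phi> S" using equiv[of S B] S B Ts by (auto simp: basic_tiles_def)
    also have "\<dots> = \<phi> T" using S trans by simp
    finally show ?thesis by simp
  qed
  have "(\<Sum>T\<in>P. \<phi> T) = (\<Sum>T\<in>P. \<Sum>i<length Ts. if Q i T then \<phi> (Ts ! i) else 0)"
    using dec by (intro sum.cong) auto
  also have "\<dots> = (\<Sum>i<length Ts. \<Sum>T\<in>P. if Q i T then \<phi> (Ts ! i) else 0)" by (rule sum.swap)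
  also have "\<dots> = (\<Sum>i<length Ts. card {T \<in> P. Q i T} * \<phi> (Ts ! i))"
  proof (intro sum.cong refl)
    fix i
    have "(\<Sum>T\<in>P. if Q i T then \<phi> (Ts ! i) else 0) = (\<Sum>T\<in>{T \<in> P. Q i T}. \<phi> (Ts ! i))"
      using P(1) by (rule sum.inter_filter[symmetric])
    then show "(\<Sum>T\<in>P. if Q i T then \<phi> (Ts ! i) else 0) = card {T \<in> P. Q i T} * \<phi> (Ts ! i)" by simp
  qed
  finally show ?thesis unfolding Q_def .
qed

definition tile_count :: "nat \<Rightarrow> (real ^ 'd) set \<Rightarrow> nat" where
  "tile_count m T = card ((infl ^^ m) {T})"

lemma tile_count_translate: "tile_count m (translate v T) = tile_count m T"
  unfolding tile_count_def using infl_power_translate[of m v "{T}"]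
  by (simp add: card_image inj_on_subset[OF inj_translate])

lemma card_supertile_Suc:
  assumes T: "T \<in> copies"
  shows "card {A \<in> (infl ^^ Suc m) {T}. Q A} = (\<Sum>T'\<in>infl {T}. card {A \<in> (infl ^^ m) {T'}. Q A})"
proof -
  have cl: "cluster (infl {T})" by (rule cluster_infl_copy(1)[OF T])
  then have c: "finite (infl {T})" "infl {T} \<subseteq> copies" by (auto simp: cluster_def)
  have "{A \<in> (infl ^^ Suc m) {T}. Q A} = (\<Union>T'\<in>infl {T}. {A \<in> (infl ^^ m) {T'}. Q A})"
    unfolding supertile_Suc by blast
  also have "card \<dots> = (\<Sum>T'\<in>infl {T}. card {A \<in> (infl ^^ m) {T'}. Q A})"
  proof (rule card_UN_disjoint[OF c(1)])
    show "\<forall>S\<in>infl {T}. finite {A \<in> (infl ^^ m) {S}. Q A}"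
      using supertile(1) c(2) by (auto simp: cluster_def)
    show "\<forall>S\<in>infl {T}. \<forall>S'\<in>infl {T}. S \<noteq> S' \<longrightarrow>
        {A \<in> (infl ^^ m) {S}. Q A} \<inter> {A \<in> (infl ^^ m) {S'}. Q A} = {}"
      using supertiles_disjoint[OF cl] by blast
  qed
  finally show ?thesis .
qed

lemma tile_count_Suc: "T \<in> copies \<Longrightarrow> tile_count (Suc m) T = (\<Sum>T'\<in>infl {T}. tile_count m T')"
  using card_supertile_Suc[of T m "\<lambda>_. True"] by (simp add: tile_count_def)

lemma infl_copy_finite: "T \<in> copies \<Longrightarrow> finite (infl {T})" "T \<in> copies \<Longrightarrow> infl {T} \<subseteq> copies"
  using cluster_infl_copy(1) by (auto simp: cluster_def)

text \<open>The well-definedness of the substitution matrix says that the inflations of \<open>S\<close> and \<open>S'\<close> contain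
  equally many tiles of every class; from there on, the induction hypothesis only sees classes.\<close>
lemma tile_count_equiv:
  assumes wd: "substitution_matrix_well_defined \<xi> Ss H"
  shows "S \<in> set Ss \<Longrightarrow> S' \<in> set Ss \<Longrightarrow> prototile_equiv H S S' \<Longrightarrow> tile_count m S = tile_count m S'"
proof (induction m arbitrary: S S')
  case 0 show ?case by (simp add: tile_count_def)
next
  case (Suc m)
  obtain Ts where Ts: "basic_tiles Ss H Ts" using basic_tiles_exist by blast
  have *: "real (tile_count (Suc m) X) = (\<Sum>i<length Ts. equiv_tile_count \<xi> Ss H (Ts ! i) X * real (tile_count m (Ts ! i)))"
    if X: "X \<in> set Ss" for X
  proof -
    have "real (tile_count (Suc m) X) = (\<Sum>T\<in>infl {X}. real (tile_count m T))"
      using tile_count_Suc[OF prototile_copy[OF X]] by simp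
    also have "\<dots> = (\<Sum>i<length Ts. equiv_tile_count \<xi> Ss H (Ts ! i) X * real (tile_count m (Ts ! i)))"
      unfolding equiv_tile_count_def
      by (rule sum_by_basic_tiles[OF Ts infl_copy_finite[OF prototile_copy[OF X]]])
        (auto simp: tile_count_translate intro: Suc.IH)
    finally show ?thesis .
  qed
  have "equiv_tile_count \<xi> Ss H (Ts ! i) S = equiv_tile_count \<xi> Ss H (Ts ! i) S'" if "i < length Ts" for i
    using wd Suc.prems that Ts unfolding substitution_matrix_well_defined_def basic_tiles_def
    by (meson nth_mem subsetD)
  then have "real (tile_count (Suc m) S) = real (tile_count (Suc m) S')"
    unfolding *[OF Suc.prems(1)] *[OF Suc.prems(2)] by (intro sum.cong) auto
  then show ?case by simp
qed

text \<open>The inflated tile is tiled by its children, which overlap in null sets only.\<close>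
lemma volume_eigenvector:
  assumes "T \<in> copies"
  shows "(\<Sum>T'\<in>infl {T}. measure lebesgue T') = \<xi> ^ CARD('d) * measure lebesgue T"
proof -
  have "(\<Sum>T'\<in>infl {T}. measure lebesgue T') = measure lebesgue (\<Union>(infl {T}))"
    using measure_Int_cluster[OF cluster_infl_copy(1)[OF assms], of UNIV] by simp
  also have "\<dots> = \<xi> ^ CARD('d) * measure lebesgue T"
    unfolding cluster_infl_copy(2)[OF assms] using xi by (simp add: measure_dilate)
  finally show ?thesis .
qed

lemma measure_copy_pos: "T \<in> copies \<Longrightarrow> 0 < measure lebesgue T"
  using min_volume measure_interior_eq[OF copy_compact negligible_frontier_copy] by force

text \<open>The tile counts and the volumes are vectors indexed by the basic tiles, and both evolve by the
  transposed substitution matrix.  Positivity of \<open>\<alpha>\<close> holds because a supertile contains at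
  least one tile while the error tends to \<open>0\<close>.\<close>
theorem tile_count_expansion:
  assumes pisot: "pisot_substitution \<xi> Ss H"
  obtains \<alpha> :: real and \<epsilon> :: "nat \<Rightarrow> real"
  where "0 < \<alpha>" "summable \<epsilon>"
    "\<And>m T. T \<in> copies \<Longrightarrow>
       \<bar>tile_count m T - \<alpha> * (\<xi> ^ m) ^ CARD('d) * measure lebesgue T\<bar> \<le> \<epsilon> m"
proof -
  have wd: "substitution_matrix_well_defined \<xi> Ss H"
    using pisot by (simp add: pisot_substitution_def)
  obtain Ts where Ts: "basic_tiles Ss H Ts" using basic_tiles_exist by blast
  have TsS: "Ts ! i \<in> set Ss" if "i < length Ts" for i
    using Ts that by (auto simp: basic_tiles_def)
  have Ts0: "0 < length Ts" using Ts Ss by (cases Ts; cases Ss) (auto simp: basic_tiles_def)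
  let ?A = "substitution_matrix \<xi> Ss H Ts" and ?n = "length Ts" and ?l = "\<xi> ^ CARD('d)"
  let ?w = "\<lambda>i. measure lebesgue (Ts ! i)"
  have A: "?A $$ (i, j) = card {T \<in> infl {Ts ! j}. \<exists>S'\<in>set Ss. prototile_equiv H S' (Ts ! i) \<and> translation_equiv T S'}"
    if "i < ?n" "j < ?n" for i j
    using that by (simp add: substitution_matrix_def equiv_tile_count_def)
  have "\<exists>\<alpha>::real. \<forall>j<?n. summable (\<lambda>m. \<bar>real (tile_count m (Ts ! j)) - \<alpha> * ?l ^ m * ?w j\<bar>)"
  proof (rule pisot_matrix_expansion[where A = ?A and ?i0.0 = 0])
    show "?A \<in> carrier_mat ?n ?n" by (simp add: substitution_matrix_def)
    show "cmod l < 1" if "second_eigenvalue (map_mat of_nat ?A) l" for l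
      using pisot Ts that by (auto simp: pisot_substitution_def)
    show "(\<Sum>i<?n. real (?A $$ (i, j)) * ?w i) = ?l * ?w j" if j: "j < ?n" for j
    proof -
      have c: "Ts ! j \<in> copies" using prototile_copy TsS[OF j] .
      have "(\<Sum>i<?n. real (?A $$ (i, j)) * ?w i) = (\<Sum>T\<in>infl {Ts ! j}. measure lebesgue T)"
        using A j
        by (subst sum_by_basic_tiles[OF Ts infl_copy_finite[OF c]])
          (auto simp: measure_prototile_equiv intro!: sum.cong)
      then show ?thesis using volume_eigenvector[OF c] by simp
    qed
    show "real (tile_count (Suc m) (Ts ! j)) = (\<Sum>i<?n. real (?A $$ (i, j)) * real (tile_count m (Ts ! i)))"
      if j: "j < ?n" for m j
    proof -
      have c: "Ts ! j \<in> copies" using prototile_copy TsS[OF j] .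
      have "real (tile_count (Suc m) (Ts ! j)) = (\<Sum>T\<in>infl {Ts ! j}. real (tile_count m T))"
        using tile_count_Suc[OF c] by simp
      also have "\<dots> = (\<Sum>i<?n. card {T \<in> infl {Ts ! j}. \<exists>S'\<in>set Ss. prototile_equiv H S' (Ts ! i) \<and> translation_equiv T S'}
          * real (tile_count m (Ts ! i)))"
        by (rule sum_by_basic_tiles[OF Ts infl_copy_finite[OF c]])
          (auto simp: tile_count_translate intro: tile_count_equiv[OF wd])
      also have "\<dots> = (\<Sum>i<?n. real (?A $$ (i, j)) * real (tile_count m (Ts ! i)))"
        using A j by (intro sum.cong) auto
      finally show ?thesis .
    qed
    show "0 < ?n" by (rule Ts0)
    show "?w 0 \<noteq> 0" using measure_copy_pos[OF prototile_copy[OF TsS[OF Ts0]]] by simp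
    show "1 \<le> ?l" using xi by simp
  qed
  then obtain \<alpha> :: real where \<alpha>: "\<And>j. j < ?n \<Longrightarrow> summable (\<lambda>m. \<bar>real (tile_count m (Ts ! j)) - \<alpha> * ?l ^ m * ?w j\<bar>)"
    by blast
  define \<epsilon> where "\<epsilon> m = (\<Sum>j<?n. \<bar>real (tile_count m (Ts ! j)) - \<alpha> * ?l ^ m * ?w j\<bar>)" for m
  have sum: "summable \<epsilon>" unfolding \<epsilon>_def using \<alpha> by (intro summable_sum) auto
  have bound: "\<bar>tile_count m T - \<alpha> * (\<xi> ^ m) ^ CARD('d) * measure lebesgue T\<bar> \<le> \<epsilon> m" if T: "T \<in> copies" for m T
  proof -
    obtain v S where S: "S \<in> set Ss" "T = translate v S" using T by (auto elim: copyE)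
    obtain B where "B \<in> set Ts" "prototile_equiv H S B"
      "\<forall>B'\<in>set Ts. prototile_equiv H S B' \<longrightarrow> B' = B"
      by (rule basic_tile_of[OF Ts S(1)])
    then obtain k where k: "k < ?n" "prototile_equiv H S (Ts ! k)" by (metis in_set_conv_nth)
    have "tile_count m T = tile_count m (Ts ! k)" "measure lebesgue T = ?w k"
      using S k TsS[OF k(1)] tile_count_equiv[OF wd] measure_prototile_equiv by (auto simp: tile_count_translate)
    moreover have "(\<xi> ^ m) ^ CARD('d) = ?l ^ m" by (simp add: power_mult[symmetric] mult.commute)
    moreover have "\<bar>real (tile_count m (Ts ! k)) - \<alpha> * ?l ^ m * ?w k\<bar> \<le> \<epsilon> m"
      unfolding \<epsilon>_def using k by (intro member_le_sum) auto
    ultimately show ?thesis by simp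
  qed
  have "0 < \<alpha>"
  proof -
    have "\<epsilon> \<longlonglongrightarrow> 0" using sum by (rule summable_LIMSEQ_zero)
    then have "eventually (\<lambda>m. \<epsilon> m < 1) sequentially" by (rule order_tendstoD) simp
    then obtain m where m: "\<epsilon> m < 1" by (auto simp: eventually_sequentially)
    obtain S where S: "S \<in> set Ss" using Ss by (cases Ss) auto
    then have Sc: "S \<in> copies" by (rule prototile_copy)
    have "dilate (\<xi> ^ m) S \<noteq> {}" using tile_nonempty[OF copy_tile[OF Sc]] by (simp add: dilate_def)
    then have "(infl ^^ m) {S} \<noteq> {}" using supertile(2)[OF Sc, of m] by auto
    then have "1 \<le> tile_count m S"
      using supertile(1)[OF Sc, of m] unfolding tile_count_def cluster_def by (simp add: Suc_leI card_gt_0_iff)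
    then have "0 < \<alpha> * ((\<xi> ^ m) ^ CARD('d) * measure lebesgue S)"
      using bound[OF Sc, of m] m by (simp add: mult.assoc)
    moreover have "0 < (\<xi> ^ m) ^ CARD('d) * measure lebesgue S" using xi measure_copy_pos[OF Sc] by simp
    ultimately show ?thesis by (simp add: zero_less_mult_iff)
  qed
  then show ?thesis using that sum bound by blast
qed

lemma supertile_avoiding_frontier:
  assumes T: "T \<in> copies" and G: "closed G"
    and avoid: "\<And>A. A \<in> (infl ^^ m) {T} \<Longrightarrow> A \<inter> frontier G = {}"
  shows "dilate (\<xi> ^ m) T \<subseteq> G \<or> dilate (\<xi> ^ m) T \<inter> G = {}"
proof (rule ccontr)
  assume not: "\<not> ?thesis"
  have "connected (dilate (\<xi> ^ m) T)"
    using tile_connected[OF tile_dilate[OF copy_tile[OF T]]] xi by simp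
  then have "dilate (\<xi> ^ m) T \<inter> frontier G \<noteq> {}"
    using not by (intro connected_Int_frontier) auto
  then show False using avoid supertile(2)[OF T, of m] by blast
qed

text \<open>Induction on the level.  If no tile meets the boundary of \<open>G\<close>, then the supertile lies inside or
  outside \<open>G\<close> and the error is at most \<open>\<epsilon> m\<close>.  Otherwise the errors of the at most \<open>k\<close> children add
  up: those that avoid the boundary cost at most \<open>k \<epsilon> m\<close> together, which is charged to one tile
  that meets the boundary, and for the others the numbers of tiles that meet the boundary add up.  At
  level \<open>0\<close> a tile on the boundary costs at most \<open>1 + \<bar>\<alpha>\<bar> V\<close>.\<close>
lemma supertile_discrepancy:
  fixes \<epsilon> :: "nat \<Rightarrow> real"
  assumes G: "compact G"
    and \<epsilon>: "\<And>m T. T \<in> copies \<Longrightarrow>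
       \<bar>tile_count m T - \<alpha> * (\<xi> ^ m) ^ CARD('d) * measure lebesgue T\<bar> \<le> \<epsilon> m"
    and V: "\<And>T. T \<in> copies \<Longrightarrow> measure lebesgue T \<le> V"
    and k: "\<And>T. T \<in> copies \<Longrightarrow> card (infl {T}) \<le> k"
  shows "T \<in> copies \<Longrightarrow>
    \<bar>card {A \<in> (infl ^^ m) {T}. A \<subseteq> G} - \<alpha> * measure lebesgue (G \<inter> dilate (\<xi> ^ m) T)\<bar>
    \<le> (if \<forall>A\<in>(infl ^^ m) {T}. A \<inter> frontier G = {} then \<epsilon> m
       else card {A \<in> (infl ^^ m) {T}. A \<inter> frontier G \<noteq> {}} * (1 + \<bar>\<alpha>\<bar> * V + k * (\<Sum>j<m. \<epsilon> j)))"
proof (induction m arbitrary: T)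
  have \<epsilon>0: "0 \<le> \<epsilon> m" for m
  proof -
    obtain S where "S \<in> set Ss" using Ss by (cases Ss) auto
    then show ?thesis using \<epsilon>[OF prototile_copy, of S m] by linarith
  qed
  have far: "\<bar>card {A \<in> (infl ^^ m) {T}. A \<subseteq> G} - \<alpha> * measure lebesgue (G \<inter> dilate (\<xi> ^ m) T)\<bar> \<le> \<epsilon> m"
    if T: "T \<in> copies" and avoid: "\<forall>A\<in>(infl ^^ m) {T}. A \<inter> frontier G = {}" for m T
  proof -
    have "dilate (\<xi> ^ m) T \<subseteq> G \<or> dilate (\<xi> ^ m) T \<inter> G = {}"
      using avoid by (intro supertile_avoiding_frontier[OF T compact_imp_closed[OF G]]) blast
    then show ?thesis
    proof
      assume "dilate (\<xi> ^ m) T \<inter> G = {}"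
      then have 1: "G \<inter> dilate (\<xi> ^ m) T = {}" by blast
      have "A \<inter> G = {} \<and> A \<noteq> {}" if A: "A \<in> (infl ^^ m) {T}" for A
      proof
        have "A \<subseteq> dilate (\<xi> ^ m) T" using A supertile(2)[OF T, of m] by blast
        then show "A \<inter> G = {}" using 1 by blast
        have "A \<in> copies" using A supertile(1)[OF T, of m] by (auto simp: cluster_def)
        then show "A \<noteq> {}" using copy_tile tile_nonempty by blast
      qed
      then have 2: "{A \<in> (infl ^^ m) {T}. A \<subseteq> G} = {}" by blast
      show ?thesis unfolding 1 2 using \<epsilon>0[of m] by simp
    next
      assume *: "dilate (\<xi> ^ m) T \<subseteq> G"
      then have 1: "G \<inter> dilate (\<xi> ^ m) T = dilate (\<xi> ^ m) T" by blast
      have 2: "{A \<in> (infl ^^ m) {T}. A \<subseteq> G} = (infl ^^ m) {T}" using * supertile(2)[OF T, of m] by blast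
      show ?thesis using \<epsilon>[OF T, of m] xi unfolding 1 2 by (simp add: measure_dilate tile_count_def mult.assoc)
    qed
  qed
  {
    case (0 T)
    show ?case
    proof (cases "\<forall>A\<in>(infl ^^ 0) {T}. A \<inter> frontier G = {}")
      case True then show ?thesis using far[OF 0, of 0] by simp
    next
      case False
      have "measure lebesgue (G \<inter> T) \<le> measure lebesgue T"
        using G copy_lmeasurable(1)[OF 0] 0 copy_compact
        by (intro measure_mono_fmeasurable) (auto simp: lmeasurable_compact compact_Int intro!: fmeasurableD)
      then have "\<bar>\<alpha>\<bar> * measure lebesgue (G \<inter> T) \<le> \<bar>\<alpha>\<bar> * V"
        using V[OF 0] by (intro mult_left_mono) auto
      then have "\<bar>\<alpha> * measure lebesgue (G \<inter> T)\<bar> \<le> \<bar>\<alpha>\<bar> * V" by (simp add: abs_mult)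
      moreover have "card {A. A = T \<and> A \<subseteq> G} \<le> 1" using card_mono[of "{T}" "{A. A = T \<and> A \<subseteq> G}"] by auto
      moreover have "{A. A = T \<and> A \<inter> frontier G \<noteq> {}} = {T}" using False by auto
      ultimately show ?thesis using False by simp
    qed
  next
    case (Suc m T)
    let ?in = "\<lambda>m T. card {A \<in> (infl ^^ m) {T}. A \<subseteq> G}"
    let ?b = "\<lambda>m T. card {A \<in> (infl ^^ m) {T}. A \<inter> frontier G \<noteq> {}}"
    let ?v = "\<lambda>m T. measure lebesgue (G \<inter> dilate (\<xi> ^ m) T)"
    let ?E = "1 + \<bar>\<alpha>\<bar> * V + k * (\<Sum>j<m. \<epsilon> j)"
    note T = Suc.prems
    show ?case
    proof (cases "\<forall>A\<in>(infl ^^ Suc m) {T}. A \<inter> frontier G = {}")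
      case True then show ?thesis using far[OF T True] by simp
    next
      case False
      have fin: "finite ((infl ^^ Suc m) {T})" using supertile(1)[OF T, of "Suc m"] by (simp add: cluster_def)
      then have "finite {A \<in> (infl ^^ Suc m) {T}. A \<inter> frontier G \<noteq> {}}" by simp
      moreover have "{A \<in> (infl ^^ Suc m) {T}. A \<inter> frontier G \<noteq> {}} \<noteq> {}" using False by blast
      ultimately have b1: "1 \<le> ?b (Suc m) T" by (simp add: Suc_leI card_gt_0_iff)
      have vol: "?v (Suc m) T = (\<Sum>T'\<in>infl {T}. ?v m T')"
      proof -
        have "dilate (\<xi> ^ Suc m) T = \<Union>((infl ^^ Suc m) {T})" by (rule supertile(2)[OF T, symmetric])
        also have "\<dots> = (\<Union>T'\<in>infl {T}. \<Union>((infl ^^ m) {T'}))" unfolding supertile_Suc by blast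
        also have "\<dots> = (\<Union>T'\<in>infl {T}. dilate (\<xi> ^ m) T')"
          using infl_copy_finite(2)[OF T] by (intro SUP_cong refl supertile(2)) blast
        finally have "G \<inter> dilate (\<xi> ^ Suc m) T = (\<Union>T'\<in>infl {T}. G \<inter> dilate (\<xi> ^ m) T')" by blast
        also have "measure lebesgue \<dots> = (\<Sum>T'\<in>infl {T}. ?v m T')"
        proof (rule measure_negligible_finite_Union_image[OF infl_copy_finite(1)[OF T]])
          fix T' assume T': "T' \<in> infl {T}"
          have "compact (dilate (\<xi> ^ m) T')"
            unfolding dilate_def using T' infl_copy_finite(2)[OF T] copy_compact by (intro compact_scaling) blast
          then show "G \<inter> dilate (\<xi> ^ m) T' \<in> lmeasurable" using G by (simp add: lmeasurable_compact compact_Int)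
        next
          show "pairwise (\<lambda>A B. negligible ((G \<inter> dilate (\<xi> ^ m) A) \<inter> (G \<inter> dilate (\<xi> ^ m) B))) (infl {T})"
          proof (rule pairwiseI)
            fix A B assume AB: "A \<in> infl {T}" "B \<in> infl {T}" "A \<noteq> B"
            have "negligible (A \<inter> B)"
              using cluster_infl_copy(1)[OF T] AB copy_compact compact_imp_closed negligible_frontier_copy
              by (intro negligible_Int_of_disjoint_interiors) (auto simp: cluster_def pairwise_def)
            moreover have "compact (A \<inter> B)"
              using AB infl_copy_finite(2)[OF T] copy_compact by (blast intro: compact_Int)
            ultimately have "negligible (dilate (\<xi> ^ m) (A \<inter> B))"
              using measure_dilate[of "\<xi> ^ m" "A \<inter> B"] \<open>compact (A \<inter> B)\<close>
              by (simp add: negligible_iff_measure lmeasurable_compact compact_scaling dilate_def)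
            then show "negligible ((G \<inter> dilate (\<xi> ^ m) A) \<inter> (G \<inter> dilate (\<xi> ^ m) B))"
              by (rule negligible_subset) (use xi in \<open>simp add: dilate_Int, blast\<close>)
          qed
        qed
        finally show ?thesis .
      qed
      have step: "\<bar>?in m T' - \<alpha> * ?v m T'\<bar> \<le> \<epsilon> m + ?b m T' * ?E" if T': "T' \<in> infl {T}" for T'
      proof -
        have "T' \<in> copies" using T' infl_copy_finite(2)[OF T] by blast
        have "0 \<le> V" using V[OF T] measure_nonneg[of lebesgue T] by linarith
        then have "0 \<le> ?E" using \<epsilon>0 by (intro add_nonneg_nonneg mult_nonneg_nonneg sum_nonneg) auto
        then have "0 \<le> real (?b m T') * ?E" by (intro mult_nonneg_nonneg) auto
        then show ?thesis using Suc.IH[OF \<open>T' \<in> copies\<close>] \<epsilon>0[of m] by (smt (verit))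
      qed
      have eq: "?in (Suc m) T - \<alpha> * ?v (Suc m) T = (\<Sum>T'\<in>infl {T}. ?in m T' - \<alpha> * ?v m T')"
        unfolding card_supertile_Suc[OF T] vol by (simp add: sum_subtractf sum_distrib_left)
      have "\<bar>?in (Suc m) T - \<alpha> * ?v (Suc m) T\<bar> \<le> (\<Sum>T'\<in>infl {T}. \<bar>?in m T' - \<alpha> * ?v m T'\<bar>)"
        unfolding eq by (rule sum_abs)
      also have "\<dots> \<le> (\<Sum>T'\<in>infl {T}. \<epsilon> m + ?b m T' * ?E)" by (intro sum_mono step)
      also have "\<dots> = card (infl {T}) * \<epsilon> m + ?b (Suc m) T * ?E"
        unfolding card_supertile_Suc[OF T] by (simp add: sum.distrib sum_distrib_right)
      also have "card (infl {T}) * \<epsilon> m \<le> ?b (Suc m) T * (k * \<epsilon> m)"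
      proof -
        have "card (infl {T}) * \<epsilon> m \<le> 1 * (k * \<epsilon> m)" using k[OF T] \<epsilon>0 by (simp add: mult_right_mono)
        also have "\<dots> \<le> ?b (Suc m) T * (k * \<epsilon> m)" using b1 \<epsilon>0 by (intro mult_right_mono) auto
        finally show ?thesis .
      qed
      finally have "\<bar>?in (Suc m) T - \<alpha> * ?v (Suc m) T\<bar>
          \<le> ?b (Suc m) T * (k * \<epsilon> m) + ?b (Suc m) T * ?E" by simp
      also have "\<dots> = ?b (Suc m) T * (1 + \<bar>\<alpha>\<bar> * V + k * (\<Sum>j<Suc m. \<epsilon> j))"
        by (simp add: distrib_left)
      finally show ?thesis unfolding if_not_P[OF False] .
    qed
  }
qed

end

section \<open>Discrepancy of substitution tilings\<close>

context tile_substitution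
begin

lemma copies_packing:
  assumes P: "P \<subseteq> copies" "pairwise (\<lambda>S T. interior S \<inter> interior T = {}) P"
    and U: "\<And>T. T \<in> P \<Longrightarrow> T \<subseteq> U" "bounded U" "U \<in> lmeasurable"
  shows "finite P" "card P * min_volume \<le> measure lebesgue U"
proof -
  have "finite P \<and> card P * min_volume \<le> measure lebesgue U"
    using P min_volume U interior_subset by (intro packing_bound) blast+
  then show "finite P" "card P * min_volume \<le> measure lebesgue U" by auto
qed

lemma substitution_tilingD:
  assumes "\<tau> \<in> substitution_tilings \<xi> Ss H"
  shows "\<tau> \<subseteq> copies" "pairwise (\<lambda>S T. interior S \<inter> interior T = {}) \<tau>" "\<Union>\<tau> = UNIV" "countable \<tau>"
proof -
  have \<tau>: "tiling_of \<tau> UNIV" "\<forall>T\<in>\<tau>. \<exists>S\<in>set Ss. translation_equiv T S"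
    using assms by (simp_all add: substitution_tilings_def)
  show "\<tau> \<subseteq> copies"
  proof
    fix T assume "T \<in> \<tau>"
    then obtain S v where "S \<in> set Ss" "T = translate v S"
      using \<tau>(2) unfolding translation_equiv_def by blast
    then show "T \<in> copies" unfolding copies_def by blast
  qed
  show "pairwise (\<lambda>S T. interior S \<inter> interior T = {}) \<tau>" "\<Union>\<tau> = UNIV" "countable \<tau>"
    using \<tau>(1) by (simp_all add: tiling_of_def)
qed

lemma bounded_tiles_meeting:
  assumes "P \<subseteq> copies" "bounded U"
  shows "bounded (\<Union>{T \<in> P. T \<inter> U \<noteq> {}})"
proof -
  obtain r where r: "\<And>x. x \<in> U \<Longrightarrow> norm x \<le> r" using assms(2) by (auto simp: bounded_iff)
  have "norm x \<le> r + max_diameter" if x: "x \<in> T" and T: "T \<in> P" "T \<inter> U \<noteq> {}" for x T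
  proof -
    obtain y where y: "y \<in> T" "y \<in> U" using T by blast
    have "norm x \<le> norm y + dist x y" using norm_triangle_ineq[of y "x - y"] by (simp add: dist_norm)
    also have "\<dots> \<le> r + max_diameter" using r y dist_le_max_diameter[of T x y] assms(1) T x by (intro add_mono) auto
    finally show ?thesis .
  qed
  then show ?thesis unfolding bounded_iff by blast
qed

lemma finite_tiles_meeting:
  assumes \<tau>: "\<tau> \<in> substitution_tilings \<xi> Ss H" and U: "bounded U"
  shows "finite {T \<in> \<tau>. T \<inter> U \<noteq> {}}"
proof -
  let ?P = "{T \<in> \<tau>. T \<inter> U \<noteq> {}}"
  have "\<exists>r>0. \<Union>?P \<subseteq> ball 0 r"
    by (rule bounded_subset_ballD[OF bounded_tiles_meeting[OF substitution_tilingD(1)[OF \<tau>] U]])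
  then obtain r where r: "\<Union>?P \<subseteq> ball 0 r" by (elim exE conjE)
  show ?thesis
  proof (rule copies_packing(1)[where U = "ball 0 r"])
    show "?P \<subseteq> copies" using substitution_tilingD(1)[OF \<tau>] by blast
    show "pairwise (\<lambda>S T. interior S \<inter> interior T = {}) ?P"
      using substitution_tilingD(2)[OF \<tau>] by (rule pairwise_subset) blast
  qed (use r in auto)
qed

lemma patch_in_supertile:
  assumes \<tau>: "\<tau> \<in> substitution_tilings \<xi> Ss H" and U: "bounded U"
  obtains m S v where "S \<in> set Ss" "translate v ` {T \<in> \<tau>. T \<inter> U \<noteq> {}} \<subseteq> (infl ^^ m) {S}"
proof -
  let ?P = "{T \<in> \<tau>. T \<inter> U \<noteq> {}}"
  note \<tau>' = substitution_tilingD[OF \<tau>]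
  have "tiling_of ?P (\<Union>?P)"
    unfolding tiling_of_def
  proof (intro conjI)
    show "countable ?P" using \<tau>'(4) by (rule countable_subset[rotated]) blast
    show "\<forall>T\<in>?P. tile T" using \<tau>'(1) copy_tile by blast
    show "pairwise (\<lambda>S T. interior S \<inter> interior T = {}) ?P" using \<tau>'(2) by (rule pairwise_subset) blast
  qed simp
  then have "patch ?P" unfolding patch_def using bounded_tiles_meeting[OF \<tau>'(1) U] by blast
  moreover have "\<forall>P. P \<subseteq> \<tau> \<and> patch P \<longrightarrow> (\<exists>m. \<exists>S\<in>set Ss. \<exists>v. translate v ` P \<subseteq> (infl ^^ m) {S})"
    using \<tau> by (simp add: substitution_tilings_def)
  moreover have "?P \<subseteq> \<tau>" by blast
  ultimately have "\<exists>m. \<exists>S\<in>set Ss. \<exists>v. translate v ` ?P \<subseteq> (infl ^^ m) {S}" by meson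
  then obtain m S v where "S \<in> set Ss" "translate v ` ?P \<subseteq> (infl ^^ m) {S}" by (elim exE bexE)
  then show ?thesis by (rule that)
qed

text \<open>The patch of tiles meeting \<open>G\<close> is a translate of a part of some supertile, in which the estimate
  for supertiles applies with a constant that does not depend on the level.  A tile of the supertile
  that lies in the translate of \<open>G\<close> belongs to the translated patch, since an open part of it is covered by
  the patch and boundaries are null sets.  The tiles on the boundary are
  not identified in this way; instead, \<open>K\<close> bounds their number in every cluster.\<close>
theorem tiling_discrepancy:
  assumes pisot: "pisot_substitution \<xi> Ss H"
  shows "\<exists>\<alpha> E :: real. 0 < \<alpha> \<and> 0 \<le> E \<and>
    (\<forall>\<tau> G K. \<tau> \<in> substitution_tilings \<xi> Ss H \<longrightarrow> compact G \<longrightarrow> G \<noteq> {} \<longrightarrow>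
       (\<forall>P. cluster P \<longrightarrow> (\<forall>T\<in>P. T \<inter> frontier G \<noteq> {}) \<longrightarrow> real (card P) \<le> K) \<longrightarrow>
       \<bar>card {T \<in> \<tau>. T \<subseteq> G} - \<alpha> * measure lebesgue G\<bar> \<le> E * K)"
proof -
  obtain \<alpha> :: real and \<epsilon> :: "nat \<Rightarrow> real" where \<alpha>: "0 < \<alpha>" and sum: "summable \<epsilon>"
    and \<epsilon>: "\<And>m T. T \<in> copies \<Longrightarrow>
       \<bar>tile_count m T - \<alpha> * (\<xi> ^ m) ^ CARD('d) * measure lebesgue T\<bar> \<le> \<epsilon> m"
    using tile_count_expansion[OF pisot] by metis
  define V where "V = Max (measure lebesgue ` set Ss)"
  define k where "k = Max (tile_count 1 ` set Ss)"
  have V: "measure lebesgue T \<le> V" if T: "T \<in> copies" for T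
    using T by (rule copyE) (simp add: V_def)
  have k: "card (infl {T}) \<le> k" if T: "T \<in> copies" for T
  proof -
    obtain v S where "S \<in> set Ss" "T = translate v S" using T by (rule copyE)
    then have "tile_count 1 T \<le> k" by (simp add: tile_count_translate k_def)
    then show ?thesis by (simp add: tile_count_def)
  qed
  obtain S0 where S0: "S0 \<in> set Ss" using Ss by (cases Ss) auto
  have \<epsilon>0: "0 \<le> \<epsilon> m" for m using \<epsilon>[OF prototile_copy[OF S0], of m] by linarith
  have "0 \<le> V" using V[OF prototile_copy[OF S0]] measure_nonneg[of lebesgue S0] by linarith
  define E where "E = 1 + \<bar>\<alpha>\<bar> * V + k * (\<Sum>j. \<epsilon> j)"
  have "0 \<le> E" unfolding E_def using \<open>0 \<le> V\<close> suminf_nonneg[OF sum \<epsilon>0] by simp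
  have "\<bar>card {T \<in> \<tau>. T \<subseteq> G} - \<alpha> * measure lebesgue G\<bar> \<le> E * K"
    if \<tau>: "\<tau> \<in> substitution_tilings \<xi> Ss H" and G: "compact G" "G \<noteq> {}"
      and K: "\<forall>P. cluster P \<longrightarrow> (\<forall>T\<in>P. T \<inter> frontier G \<noteq> {}) \<longrightarrow> real (card P) \<le> K" for \<tau> G K
  proof -
    note \<tau>' = substitution_tilingD[OF \<tau>]
    let ?P = "{T \<in> \<tau>. T \<inter> G \<noteq> {}}"
    obtain m S v where S: "S \<in> set Ss" and sub: "translate v ` ?P \<subseteq> (infl ^^ m) {S}"
      by (rule patch_in_supertile[OF \<tau> compact_imp_bounded[OF G(1)]])
    let ?W = "(infl ^^ m) {S}" and ?G = "translate v G"
    have Sc: "S \<in> copies" using S by (rule prototile_copy)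
    have W: "finite ?W" "?W \<subseteq> copies" "pairwise (\<lambda>S T. interior S \<inter> interior T = {}) ?W"
      using supertile(1)[OF Sc, of m] by (auto simp: cluster_def)
    have cG: "compact ?G" unfolding translate_def using G(1) by (rule compact_translation)
    have GP: "G \<subseteq> \<Union>?P" using \<tau>'(3) by blast
    then have G_sub: "?G \<subseteq> \<Union>(translate v ` ?P)" unfolding translate_def by blast
    then have GW: "?G \<subseteq> dilate (\<xi> ^ m) S" using sub supertile(2)[OF Sc, of m] by blast
    have inside: "{A \<in> ?W. A \<subseteq> ?G} = translate v ` {T \<in> \<tau>. T \<subseteq> G}"
    proof (intro equalityI subsetI)
      fix A assume "A \<in> {A \<in> ?W. A \<subseteq> ?G}"
      then have A: "A \<in> ?W" "A \<subseteq> ?G" by auto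
      have ne: "interior A \<noteq> {}" using A W(2) copy_tile tile_interior_nonempty by blast
      have fin: "finite ?P" by (rule finite_tiles_meeting[OF \<tau> compact_imp_bounded[OF G(1)]])
      then have "negligible (\<Union>(frontier ` (translate v ` ?P)))"
        using \<tau>'(1) negligible_frontier_copy translate_copy by (intro negligible_Union) auto
      then have "\<not> interior A \<subseteq> \<Union>(frontier ` (translate v ` ?P))"
        using open_not_negligible[OF open_interior ne] negligible_subset by blast
      then obtain x where x: "x \<in> interior A" "x \<notin> \<Union>(frontier ` (translate v ` ?P))" by blast
      then have "x \<in> ?G" using A(2) interior_subset by blast
      then obtain T where T: "T \<in> ?P" "x \<in> translate v T" using G_sub by blast
      then have "x \<in> interior (translate v T)"
        using x(2) closure_subset[of "translate v T"] unfolding frontier_def by blast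
      moreover have "translate v T \<in> ?W" using T(1) sub by blast
      ultimately have "A = translate v T" using W(3) A(1) x(1) unfolding pairwise_def by blast
      then show "A \<in> translate v ` {T \<in> \<tau>. T \<subseteq> G}" using A(2) T(1) by simp
    next
      fix A assume "A \<in> translate v ` {T \<in> \<tau>. T \<subseteq> G}"
      then obtain T where T: "T \<in> \<tau>" "T \<subseteq> G" "A = translate v T" by blast
      have "T \<noteq> {}" using T(1) \<tau>'(1) copy_tile tile_nonempty by blast
      then have "T \<in> ?P" using T by blast
      then show "A \<in> {A \<in> ?W. A \<subseteq> ?G}" using sub T by auto
    qed
    let ?B = "{A \<in> ?W. A \<inter> frontier ?G \<noteq> {}}"
    have "frontier ?G \<noteq> {}"
      using G cG by (auto simp: frontier_eq_empty translate_def dest: compact_imp_bounded)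
    moreover have "frontier ?G \<subseteq> \<Union>?W"
      using cG GW supertile(2)[OF Sc, of m] by (auto simp: frontier_def compact_imp_closed)
    ultimately have "?B \<noteq> {}" by blast
    have "real (card ?B) = card (translate (- v) ` ?B)"
      by (simp add: card_image inj_on_subset[OF inj_translate])
    also have "\<dots> \<le> K"
    proof (rule K[rule_format])
      have "cluster ?B" using W unfolding cluster_def by (auto intro: pairwise_subset)
      then show "cluster (translate (- v) ` ?B)" by (rule cluster_translate)
      fix T assume "T \<in> translate (- v) ` ?B"
      then obtain A where A: "A \<inter> frontier ?G \<noteq> {}" "T = translate (- v) A" by blast
      have "T \<inter> frontier G = translate (- v) (A \<inter> frontier ?G)"
        by (simp add: A translate_Int frontier_translate)
      then show "T \<inter> frontier G \<noteq> {}" using A(1) by (simp add: translate_def)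
    qed
    finally have BK: "real (card ?B) \<le> K" .
    have "\<bar>card {A \<in> ?W. A \<subseteq> ?G} - \<alpha> * measure lebesgue (?G \<inter> dilate (\<xi> ^ m) S)\<bar>
        \<le> (if \<forall>A\<in>?W. A \<inter> frontier ?G = {} then \<epsilon> m
           else card ?B * (1 + \<bar>\<alpha>\<bar> * V + k * (\<Sum>j<m. \<epsilon> j)))"
      by (rule supertile_discrepancy[OF cG \<epsilon> V k Sc])
    also have "\<dots> = card ?B * (1 + \<bar>\<alpha>\<bar> * V + k * (\<Sum>j<m. \<epsilon> j))"
      using \<open>?B \<noteq> {}\<close> by (intro if_not_P) blast
    also have "\<dots> \<le> card ?B * E"
      unfolding E_def using sum \<epsilon>0
      by (intro mult_left_mono add_left_mono sum_le_suminf) auto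
    also have "\<dots> \<le> K * E" using BK \<open>0 \<le> E\<close> by (rule mult_right_mono)
    finally have "\<bar>card {A \<in> ?W. A \<subseteq> ?G} - \<alpha> * measure lebesgue (?G \<inter> dilate (\<xi> ^ m) S)\<bar> \<le> E * K"
      by (simp add: mult.commute)
    moreover have "?G \<inter> dilate (\<xi> ^ m) S = ?G" using GW by blast
    moreover have "card {A \<in> ?W. A \<subseteq> ?G} = card {T \<in> \<tau>. T \<subseteq> G}"
      unfolding inside by (simp add: card_image inj_on_subset[OF inj_translate])
    ultimately show ?thesis by simp
  qed
  then show ?thesis
    by (intro exI[of _ \<alpha>] exI[of _ E] conjI allI impI \<alpha> \<open>0 \<le> E\<close>)
qed

end

section \<open>Cubes and lattice points\<close>

definition cube :: "real \<Rightarrow> int ^ 'd \<Rightarrow> (real ^ 'd) set" where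
  "cube s q = cbox (\<chi> i. s * of_int (q $ i)) (\<chi> i. s * (of_int (q $ i) + 1))"

text \<open>Cubes with a common point, including those that touch only at a corner; a cube is adjacent to
  itself.\<close>
definition adjacent :: "int ^ 'd \<Rightarrow> int ^ 'd \<Rightarrow> bool" where
  "adjacent q q' \<longleftrightarrow> (\<forall>i. \<bar>q $ i - q' $ i\<bar> \<le> 1)"

definition neighbours :: "(int ^ 'd) set \<Rightarrow> (int ^ 'd) set" where
  "neighbours A = {q'. \<exists>q\<in>A. adjacent q q'}"

text \<open>With cubes of side \<open>L \<beta>\<close>, this is the index of the half-open cube that contains the lattice point
  \<open>\<beta> z\<close>.\<close>
definition cell :: "nat \<Rightarrow> int ^ 'd \<Rightarrow> int ^ 'd" where
  "cell L z = (\<chi> i. z $ i div int L)"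

lemma mem_cube: "x \<in> cube s q \<longleftrightarrow> (\<forall>i. s * of_int (q $ i) \<le> x $ i \<and> x $ i \<le> s * (of_int (q $ i) + 1))"
  by (simp add: cube_def mem_box_cart)

lemma compact_cube: "compact (cube s q)"
  by (simp add: cube_def)

lemma cube_nonempty: "0 \<le> s \<Longrightarrow> cube s q \<noteq> {}"
  by (auto simp: cube_def interval_ne_empty_cart intro: mult_left_mono)

lemma measure_cube:
  assumes "0 \<le> s" shows "measure lebesgue (cube s (q :: int ^ 'd)) = s ^ CARD('d)"
proof -
  have "measure lebesgue (cube s q) = measure lborel (cube s q)"
    by (simp add: cube_def measure_completion)
  also have "\<dots> = (\<Prod>i\<in>(UNIV :: 'd set). s)"
    using cube_nonempty[OF assms, of q] unfolding cube_def
    by (subst content_cbox_cart) (auto simp: algebra_simps)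
  finally show ?thesis by simp
qed

lemma cube_covers:
  assumes "0 < s" obtains q where "x \<in> cube s q"
proof -
  have "x \<in> cube s (\<chi> i. \<lfloor>x $ i / s\<rfloor>)"
    unfolding mem_cube
  proof
    fix i
    have "s * of_int \<lfloor>x $ i / s\<rfloor> \<le> s * (x $ i / s)" "s * (x $ i / s) \<le> s * (of_int \<lfloor>x $ i / s\<rfloor> + 1)"
      using assms by (intro mult_left_mono; linarith)+
    then show "s * of_int ((\<chi> i. \<lfloor>x $ i / s\<rfloor>) $ i) \<le> x $ i \<and> x $ i \<le> s * (of_int ((\<chi> i. \<lfloor>x $ i / s\<rfloor>) $ i) + 1)"
      using assms by simp
  qed
  then show ?thesis by (rule that)
qed

lemma interior_cube_disjoint:
  assumes "0 < s" "q \<noteq> q'" shows "interior (cube s q) \<inter> cube s q' = {}"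
proof -
  obtain i where i: "q $ i \<noteq> q' $ i" using assms(2) unfolding Finite_Cartesian_Product.vec_eq_iff by blast
  have False if x: "x \<in> interior (cube s q)" "x \<in> cube s q'" for x
  proof -
    have "s * of_int (q $ i) < x $ i" "x $ i < s * (of_int (q $ i) + 1)"
      using x(1) by (simp_all add: cube_def mem_box_cart)
    moreover have "s * of_int (q' $ i) \<le> x $ i" "x $ i \<le> s * (of_int (q' $ i) + 1)"
      using x(2) by (simp_all add: mem_cube)
    ultimately have "s * of_int (q $ i) < s * (of_int (q' $ i) + 1)" "s * of_int (q' $ i) < s * (of_int (q $ i) + 1)"
      by linarith+
    then have "real_of_int (q $ i) < of_int (q' $ i) + 1" "real_of_int (q' $ i) < of_int (q $ i) + 1"
      using assms(1) by simp_all
    then show False using i by linarith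
  qed
  then show ?thesis by blast
qed

lemma card_int_box:
  fixes X :: "'d::finite \<Rightarrow> int set"
  assumes "\<And>i. finite (X i)"
  shows "finite {q :: int ^ 'd. \<forall>i. q $ i \<in> X i}" "card {q :: int ^ 'd. \<forall>i. q $ i \<in> X i} = (\<Prod>i\<in>UNIV. card (X i))"
proof -
  have "bij_betw vec_lambda (PiE UNIV X) {q :: int ^ 'd. \<forall>i. q $ i \<in> X i}"
    by (rule bij_betw_byWitness[where f' = vec_nth]) (auto simp: PiE_def Pi_def)
  then show "finite {q :: int ^ 'd. \<forall>i. q $ i \<in> X i}" "card {q :: int ^ 'd. \<forall>i. q $ i \<in> X i} = (\<Prod>i\<in>UNIV. card (X i))"
    using assms finite_PiE[of UNIV X] card_PiE[of UNIV X] bij_betw_finite bij_betw_same_card by fastforce+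
qed

lemma finite_cubes_meeting:
  assumes s: "0 < s" and U: "bounded U"
  shows "finite {q. cube s q \<inter> U \<noteq> {}}"
proof -
  obtain r where r: "\<And>x. x \<in> U \<Longrightarrow> norm x \<le> r" using U by (auto simp: bounded_iff)
  have "finite {q :: int ^ 'a. \<forall>i. q $ i \<in> {\<lfloor>- r / s\<rfloor> - 1..\<lceil>r / s\<rceil>}}" by (rule card_int_box) auto
  moreover have "{q. cube s q \<inter> U \<noteq> {}} \<subseteq> {q. \<forall>i. q $ i \<in> {\<lfloor>- r / s\<rfloor> - 1..\<lceil>r / s\<rceil>}}"
  proof (intro subsetI CollectI allI)
    fix q i assume "q \<in> {q. cube s q \<inter> U \<noteq> {}}"
    then obtain x where x: "x \<in> cube s q" "x \<in> U" by blast
    have "\<bar>x $ i\<bar> \<le> r" using r[OF x(2)] component_le_norm_cart[of x i] by linarith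
    then have "s * of_int (q $ i) \<le> r" "- r \<le> s * (of_int (q $ i) + 1)"
      using x(1) by (auto simp: mem_cube abs_le_iff intro: order_trans) (smt (verit))
    then have "of_int (q $ i) \<le> r / s" "- r / s \<le> of_int (q $ i) + 1"
      using s by (simp_all add: field_simps)
    then show "q $ i \<in> {\<lfloor>- r / s\<rfloor> - 1..\<lceil>r / s\<rceil>}" by (simp, linarith)
  qed
  ultimately show ?thesis by (rule finite_subset[rotated])
qed

lemma neighbours_superset: "A \<subseteq> neighbours A"
  unfolding neighbours_def adjacent_def by force

lemma finite_neighbours:
  assumes "finite A" shows "finite (neighbours A)"
proof -
  have "{q'. adjacent q q'} = {q'. \<forall>i. q' $ i \<in> {q $ i - 1..q $ i + 1}}" for q :: "int ^ 'a"
  proof -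
    have "\<bar>a - b\<bar> \<le> 1 \<longleftrightarrow> b \<in> {a - 1..a + 1}" for a b :: int by (simp, linarith)
    then show ?thesis unfolding adjacent_def by simp
  qed
  then have "finite {q'. adjacent q q'}" for q :: "int ^ 'a" by (simp only:) (rule card_int_box, simp)
  moreover have "neighbours A = (\<Union>q\<in>A. {q'. adjacent q q'})" unfolding neighbours_def by blast
  ultimately show ?thesis using assms by simp
qed

lemma adjacent_if_cubes_meet:
  assumes "0 < s" "x \<in> cube s q" "x \<in> cube s q'" shows "adjacent q q'"
  unfolding adjacent_def
proof
  fix i
  have "s * of_int (q $ i) \<le> s * (of_int (q' $ i) + 1)" "s * of_int (q' $ i) \<le> s * (of_int (q $ i) + 1)"
    using assms(2,3) unfolding mem_cube by (meson order_trans)+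
  then have "real_of_int (q $ i) \<le> of_int (q' $ i) + 1" "real_of_int (q' $ i) \<le> of_int (q $ i) + 1"
    using assms(1) by simp_all
  then show "\<bar>q $ i - q' $ i\<bar> \<le> 1" by linarith
qed

text \<open>Only finitely many cubes come near \<open>x\<close>.  If all those containing \<open>x\<close> had their index in \<open>A\<close>, then
  the others would keep away from a neighbourhood of \<open>x\<close>, and \<open>x\<close> would be an interior point.\<close>
lemma frontier_cubes_subset:
  assumes s: "0 < s" and A: "finite A"
  shows "frontier (\<Union>(cube s ` A)) \<subseteq> (\<Union>q\<in>neighbours A - A. frontier (cube s q))"
proof
  fix x assume x: "x \<in> frontier (\<Union>(cube s ` A))"
  have "closed (\<Union>(cube s ` A))" using A compact_imp_closed[OF compact_cube] by (intro closed_Union) auto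
  then have "x \<in> \<Union>(cube s ` A)" "x \<notin> interior (\<Union>(cube s ` A))" using x by (auto simp: frontier_def)
  then obtain p where p: "p \<in> A" "x \<in> cube s p" by blast
  define F where "F = {q. cube s q \<inter> ball x 1 \<noteq> {}} - A"
  have "finite F" unfolding F_def by (intro finite_Diff finite_cubes_meeting s bounded_ball)
  then have clF: "closed (\<Union>(cube s ` F))" using compact_imp_closed[OF compact_cube] by (intro closed_Union) auto
  have "x \<in> \<Union>(cube s ` F)"
  proof (rule ccontr)
    assume "x \<notin> \<Union>(cube s ` F)"
    then have "x \<in> ball x 1 - \<Union>(cube s ` F)" by simp
    moreover have "ball x 1 - \<Union>(cube s ` F) \<subseteq> \<Union>(cube s ` A)"
    proof
      fix y assume y: "y \<in> ball x 1 - \<Union>(cube s ` F)"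
      obtain q where q: "y \<in> cube s q" by (rule cube_covers[OF s])
      then show "y \<in> \<Union>(cube s ` A)" using y unfolding F_def by blast
    qed
    moreover have "open (ball x 1 - \<Union>(cube s ` F))" using clF by (intro open_Diff) auto
    ultimately have "x \<in> interior (\<Union>(cube s ` A))" by (meson interiorI)
    then show False using \<open>x \<notin> interior (\<Union>(cube s ` A))\<close> by blast
  qed
  then obtain q where q: "q \<in> F" "x \<in> cube s q" by blast
  have "q \<notin> A" using q unfolding F_def by blast
  moreover have "q \<in> neighbours A"
    unfolding neighbours_def using adjacent_if_cubes_meet[OF s p(2) q(2)] p(1) by blast
  moreover have "x \<in> frontier (cube s q)"
  proof -
    have "p \<noteq> q" using p(1) \<open>q \<notin> A\<close> by blast
    then have "x \<notin> interior (cube s q)" using interior_cube_disjoint[OF s, of q p] p(2) by blast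
    then show ?thesis using q(2) closure_subset unfolding frontier_def by blast
  qed
  ultimately show "x \<in> (\<Union>q\<in>neighbours A - A. frontier (cube s q))" by blast
qed

lemma card_cell:
  assumes L: "0 < L" and A: "finite (A :: (int ^ 'd) set)"
  shows "finite {z. cell L z \<in> A}" "card {z. cell L z \<in> A} = card A * L ^ CARD('d)"
proof -
  have eq: "{z. cell L z = q} = {z. \<forall>i. z $ i \<in> {int L * q $ i..<int L * q $ i + int L}}" for q :: "int ^ 'd"
  proof -
    have "z div int L = a \<longleftrightarrow> z \<in> {int L * a..<int L * a + int L}" for z a :: int
    proof
      assume "z div int L = a"
      then show "z \<in> {int L * a..<int L * a + int L}"
        using L mult_div_mod_eq[of "int L" z] pos_mod_bound[of "int L" z] pos_mod_sign[of "int L" z]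
        by (simp, linarith)
    next
      assume "z \<in> {int L * a..<int L * a + int L}"
      then have "0 \<le> z - int L * a" "z - int L * a < int L" by auto
      moreover have "z = int L * a + (z - int L * a)" by simp
      ultimately show "z div int L = a" by (metis div_pos_pos_trivial div_mult_self4 L add.commute add_0 of_nat_0_less_iff less_irrefl)
    qed
    then show ?thesis unfolding cell_def Finite_Cartesian_Product.vec_eq_iff by simp
  qed
  have fin: "finite {z. cell L z = q}" and cd: "card {z. cell L z = q} = L ^ CARD('d)" for q :: "int ^ 'd"
    unfolding eq by (rule card_int_box, simp) (subst card_int_box, auto)
  have un: "{z. cell L z \<in> A} = (\<Union>q\<in>A. {z. cell L z = q})" by blast
  show "finite {z. cell L z \<in> A}" unfolding un using A fin by simp
  show "card {z. cell L z \<in> A} = card A * L ^ CARD('d)"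
    unfolding un by (subst card_UN_disjoint) (use A fin cd in auto)
qed

section \<open>Tiles near the boundary of a union of cubes\<close>

text \<open>The part of space within \<open>\<delta>\<close> of the boundary of a cube, in the maximum norm.\<close>
definition shell :: "real \<Rightarrow> real \<Rightarrow> int ^ 'd \<Rightarrow> (real ^ 'd) set" where
  "shell \<delta> s q = cbox (\<chi> i. s * of_int (q $ i) - \<delta>) (\<chi> i. s * (of_int (q $ i) + 1) + \<delta>)
     - box (\<chi> i. s * of_int (q $ i) + \<delta>) (\<chi> i. s * (of_int (q $ i) + 1) - \<delta>)"

lemma frontier_cube: "frontier (cube s q) = cube s q - interior (cube s q)"
  using compact_imp_closed[OF compact_cube, of s q] by (simp add: frontier_def)

lemma negligible_frontier_cube: "negligible (frontier (cube s q))"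
  unfolding frontier_cube by (simp add: cube_def negligible_frontier_interval)

lemma lmeasurable_shell: "shell \<delta> s q \<in> lmeasurable" "bounded (shell \<delta> s q)"
  unfolding shell_def by (auto intro: fmeasurable_Diff)

lemma measure_shell:
  assumes "0 \<le> \<delta>" "2 * \<delta> \<le> s"
  shows "measure lebesgue (shell \<delta> s (q :: int ^ 'd)) = (s + 2 * \<delta>) ^ CARD('d) - (s - 2 * \<delta>) ^ CARD('d)"
proof -
  let ?a = "\<chi> i. s * of_int (q $ i) - \<delta>" and ?b = "\<chi> i. s * (of_int (q $ i) + 1) + \<delta>"
  let ?c = "\<chi> i. s * of_int (q $ i) + \<delta>" and ?d = "\<chi> i. s * (of_int (q $ i) + 1) - \<delta>"
  have out: "cbox ?a ?b \<noteq> {}" and inn: "cbox ?c ?d \<noteq> {}"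
    unfolding interval_ne_empty_cart using assms by (auto simp: algebra_simps)
  have "box ?c ?d \<subseteq> cbox ?a ?b"
  proof (unfold subset_iff mem_box_cart, intro allI impI)
    fix x :: "real ^ 'd" and i
    assume "\<forall>i. ?c $ i < x $ i \<and> x $ i < ?d $ i"
    then have "?c $ i < x $ i \<and> x $ i < ?d $ i" by blast
    then show "?a $ i \<le> x $ i \<and> x $ i \<le> ?b $ i" using assms by simp
  qed
  then have "measure lebesgue (shell \<delta> s q) = measure lebesgue (cbox ?a ?b) - measure lebesgue (box ?c ?d)"
    unfolding shell_def by (intro measurable_measure_Diff) auto
  also have "measure lebesgue (cbox ?a ?b) = measure lborel (cbox ?a ?b)"
    by (simp add: measure_completion)
  also have "\<dots> = (\<Prod>i\<in>(UNIV :: 'd set). s + 2 * \<delta>)"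
    by (subst content_cbox_cart[OF out]) (auto simp: algebra_simps)
  also have "measure lebesgue (box ?c ?d) = measure lborel (cbox ?c ?d)"
    by (simp add: measure_completion measure_lborel_box_eq measure_lborel_cbox_eq)
  also have "\<dots> = (\<Prod>i\<in>(UNIV :: 'd set). s - 2 * \<delta>)"
    by (subst content_cbox_cart[OF inn]) (simp add: algebra_simps)
  finally show ?thesis by simp
qed

lemma subset_shell:
  assumes T: "\<And>x y. x \<in> T \<Longrightarrow> y \<in> T \<Longrightarrow> dist x y \<le> \<delta>" and meet: "T \<inter> frontier (cube s q) \<noteq> {}"
  shows "T \<subseteq> shell \<delta> s q"
proof
  fix y assume "y \<in> T"
  obtain x where x: "x \<in> T" "x \<in> cube s q" "x \<notin> interior (cube s q)"
    using meet unfolding frontier_cube by blast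
  have near: "\<bar>y $ i - x $ i\<bar> \<le> \<delta>" for i
    using component_le_norm_cart[of "y - x" i] T[OF \<open>y \<in> T\<close> x(1)] by (simp add: dist_norm)
  have "\<exists>i. x $ i \<le> s * of_int (q $ i) \<or> s * (of_int (q $ i) + 1) \<le> x $ i"
    using x(3) by (simp add: cube_def mem_box_cart not_less)
  then obtain k where k: "x $ k \<le> s * of_int (q $ k) \<or> s * (of_int (q $ k) + 1) \<le> x $ k" by blast
  have "y \<notin> box (\<chi> i. s * of_int (q $ i) + \<delta>) (\<chi> i. s * (of_int (q $ i) + 1) - \<delta>)"
  proof
    assume "y \<in> box (\<chi> i. s * of_int (q $ i) + \<delta>) (\<chi> i. s * (of_int (q $ i) + 1) - \<delta>)"
    then have "s * of_int (q $ k) + \<delta> < y $ k" "y $ k < s * (of_int (q $ k) + 1) - \<delta>"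
      by (simp_all add: mem_box_cart)
    then show False using k near[of k] by linarith
  qed
  moreover have "y \<in> cbox (\<chi> i. s * of_int (q $ i) - \<delta>) (\<chi> i. s * (of_int (q $ i) + 1) + \<delta>)"
    unfolding mem_box_cart
  proof
    fix i
    have "s * of_int (q $ i) \<le> x $ i" "x $ i \<le> s * (of_int (q $ i) + 1)" using x(2) by (simp_all add: mem_cube)
    then show "(\<chi> i. s * of_int (q $ i) - \<delta>) $ i \<le> y $ i \<and> y $ i \<le> (\<chi> i. s * (of_int (q $ i) + 1) + \<delta>) $ i"
      using near[of i] by (simp, linarith)
  qed
  ultimately show "y \<in> shell \<delta> s q" unfolding shell_def by blast
qed

lemma measure_cubes:
  fixes s :: real and A :: "(int ^ 'd) set"
  assumes s: "0 < s" and A: "finite A"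
  shows "measure lebesgue (\<Union>(cube s ` A)) = card A * s ^ CARD('d)"
proof -
  have "measure lebesgue (\<Union>(cube s ` A)) = (\<Sum>q\<in>A. measure lebesgue (cube s q))"
  proof (rule measure_negligible_finite_Union_image[OF A])
    show "cube s q \<in> lmeasurable" for q :: "int ^ 'd" by (simp add: cube_def)
    show "pairwise (\<lambda>p q. negligible (cube s p \<inter> cube s q)) A"
    proof (rule pairwiseI)
      fix p q assume "p \<in> A" "q \<in> A" "p \<noteq> q"
      have "interior (cube s p) \<inter> interior (cube s q) = {}"
        using interior_cube_disjoint[OF s \<open>p \<noteq> q\<close>] interior_subset by blast
      then show "negligible (cube s p \<inter> cube s q)"
        by (intro negligible_Int_of_disjoint_interiors negligible_frontier_cube compact_imp_closed compact_cube)
    qed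
  qed
  then show ?thesis using s by (simp add: measure_cube)
qed

context tile_substitution
begin

text \<open>The volume of a shell of width \<open>max_diameter\<close> about the boundary of a cube of side \<open>s\<close>, in units
  of the least tile volume; it bounds the number of tiles that meet this boundary.\<close>
definition frontier_bound :: "real \<Rightarrow> real" where
  "frontier_bound s =
     ((s + 2 * max_diameter) ^ CARD('d) - (s - 2 * max_diameter) ^ CARD('d)) / min_volume"

lemma frontier_bound_nonneg: "2 * max_diameter \<le> s \<Longrightarrow> 0 \<le> frontier_bound s"
  unfolding frontier_bound_def using min_volume(1) max_diameter_nonneg
  by (intro divide_nonneg_pos) (auto intro!: power_mono)

lemma card_meeting_frontier_cube:
  assumes P: "cluster P" "\<And>T. T \<in> P \<Longrightarrow> T \<inter> frontier (cube s q) \<noteq> {}" and s: "2 * max_diameter \<le> s"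
  shows "card P \<le> frontier_bound s"
proof -
  have "card P * min_volume \<le> measure lebesgue (shell max_diameter s q)"
  proof (rule copies_packing(2))
    show "P \<subseteq> copies" "pairwise (\<lambda>S T. interior S \<inter> interior T = {}) P"
      using P(1) by (auto simp: cluster_def)
    then show "T \<subseteq> shell max_diameter s q" if "T \<in> P" for T
      using that P(2) dist_le_max_diameter by (intro subset_shell) auto
  qed (rule lmeasurable_shell)+
  also have "\<dots> = (s + 2 * max_diameter) ^ CARD('d) - (s - 2 * max_diameter) ^ CARD('d)"
    by (rule measure_shell[OF max_diameter_nonneg s])
  finally show ?thesis unfolding frontier_bound_def using min_volume(1) by (simp add: pos_le_divide_eq)
qed

lemma card_meeting_frontier_cubes:
  assumes s: "0 < s" "2 * max_diameter \<le> s" and A: "finite A"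
    and P: "cluster P" "\<And>T. T \<in> P \<Longrightarrow> T \<inter> frontier (\<Union>(cube s ` A)) \<noteq> {}"
  shows "card P \<le> card (neighbours A - A) * frontier_bound s"
proof -
  let ?B = "neighbours A - A"
  have fin: "finite ?B" using A finite_neighbours by blast
  have "P \<subseteq> (\<Union>q\<in>?B. {T \<in> P. T \<inter> frontier (cube s q) \<noteq> {}})"
  proof
    fix T assume T: "T \<in> P"
    obtain x where x: "x \<in> T" "x \<in> frontier (\<Union>(cube s ` A))" using P(2)[OF T] by blast
    obtain q where "q \<in> ?B" "x \<in> frontier (cube s q)"
      using subsetD[OF frontier_cubes_subset[OF s(1) A] x(2)] by (elim UN_E)
    then show "T \<in> (\<Union>q\<in>?B. {T \<in> P. T \<inter> frontier (cube s q) \<noteq> {}})" using T x(1) by blast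
  qed
  moreover have "finite P" using P(1) by (simp add: cluster_def)
  ultimately have "card P \<le> card (\<Union>q\<in>?B. {T \<in> P. T \<inter> frontier (cube s q) \<noteq> {}})"
    using fin by (intro card_mono) auto
  also have "\<dots> \<le> (\<Sum>q\<in>?B. card {T \<in> P. T \<inter> frontier (cube s q) \<noteq> {}})"
    by (rule card_UN_le[OF fin])
  finally have "real (card P) \<le> (\<Sum>q\<in>?B. real (card {T \<in> P. T \<inter> frontier (cube s q) \<noteq> {}}))"
    using of_nat_mono by fastforce
  also have "\<dots> \<le> (\<Sum>q\<in>?B. frontier_bound s)"
  proof (intro sum_mono card_meeting_frontier_cube[OF _ _ s(2)])
    show "cluster {T \<in> P. T \<inter> frontier (cube s q) \<noteq> {}}" for q
      using P(1) unfolding cluster_def by (auto intro: pairwise_subset)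
  qed blast
  finally show ?thesis by simp
qed

text \<open>The bound is a polynomial in \<open>s\<close> of degree less than \<open>d\<close>, while the number of lattice points in a
  cube of side \<open>L \<beta>\<close> is \<open>L\<^sup>d\<close>.\<close>
lemma frontier_bound_small:
  fixes \<beta> :: real
  assumes \<beta>: "0 < \<beta>"
  obtains L :: nat where "0 < L" "2 * max_diameter \<le> L * \<beta>" "C * frontier_bound (L * \<beta>) \<le> real L ^ CARD('d)"
proof -
  let ?d = max_diameter and ?n = "CARD('d)"
  let ?f = "\<lambda>L :: nat. C * (((\<beta> + 2 * ?d * inverse (real L)) ^ ?n - (\<beta> - 2 * ?d * inverse (real L)) ^ ?n) / min_volume)"
  have "?f \<longlonglongrightarrow> C * (((\<beta> + 2 * ?d * 0) ^ ?n - (\<beta> - 2 * ?d * 0) ^ ?n) / min_volume)"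
    using min_volume(1) by (intro tendsto_intros lim_inverse_n) auto
  then have "?f \<longlonglongrightarrow> 0" by simp
  then have "eventually (\<lambda>L. ?f L < 1) sequentially" by (rule order_tendstoD) simp
  moreover have "eventually (\<lambda>L :: nat. 2 * ?d / \<beta> \<le> real L) sequentially"
    using filterlim_real_sequentially unfolding filterlim_at_top by blast
  moreover have "eventually (\<lambda>L :: nat. 0 < L) sequentially" by (rule eventually_gt_at_top)
  ultimately have "eventually (\<lambda>L. ?f L < 1 \<and> 2 * ?d / \<beta> \<le> real L \<and> 0 < L) sequentially"
    by (intro eventually_conj)
  then obtain L :: nat where L: "?f L < 1" "2 * ?d / \<beta> \<le> real L" "0 < L"
    by (auto simp: eventually_sequentially)
  have eq: "(L * \<beta> + c) ^ ?n = real L ^ ?n * (\<beta> + c * inverse (real L)) ^ ?n" for c :: real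
  proof -
    have "L * \<beta> + c = real L * (\<beta> + c * inverse (real L))" using L(3) by (simp add: distrib_left)
    then show ?thesis by (simp only: power_mult_distrib)
  qed
  have "C * frontier_bound (L * \<beta>) = real L ^ ?n * ?f L"
    unfolding frontier_bound_def using eq[of "2 * ?d"] eq[of "- (2 * ?d)"]
    by (simp add: right_diff_distrib diff_divide_distrib mult_ac)
  also have "\<dots> \<le> real L ^ ?n * 1" using L(1) by (intro mult_left_mono) auto
  finally have "C * frontier_bound (L * \<beta>) \<le> real L ^ ?n" by simp
  moreover have "2 * ?d \<le> L * \<beta>" using L(2) \<beta> by (simp add: divide_le_eq)
  ultimately show ?thesis using L(3) that by blast
qed

end

section \<open>Matching tiles with lattice points\<close>

context tile_substitution
begin

text \<open>The lattice points \<open>\<beta> z\<close> are grouped into cubes of side \<open>s = L \<beta>\<close>, each holding \<open>L\<^sup>d = \<alpha> s\<^sup>d\<close> of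
  them.  A tile may be matched with the lattice points of the cubes that it meets and of the
  cubes adjacent to these.  For a finite set of tiles let \<open>A\<close> be the set of cubes meeting it; for a
  finite set of lattice points let \<open>A\<close> be the set of cubes holding it.  In both cases the discrepancy
  of the union of \<open>A\<close> is at most \<open>(E + 1) K\<close> for each cube adjacent to \<open>A\<close>, and such a cube holds
  enough lattice points, or contains enough tiles, to compensate for that.\<close>
theorem tiles_to_lattice:
  assumes pisot: "pisot_substitution \<xi> Ss H" and \<tau>: "\<tau> \<in> substitution_tilings \<xi> Ss H"
  obtains \<beta> C :: real and h :: "(real ^ 'd) set \<Rightarrow> int ^ 'd"
  where "0 < \<beta>" "bij_betw h \<tau> UNIV"
    "\<And>T x i. T \<in> \<tau> \<Longrightarrow> x \<in> T \<Longrightarrow> \<bar>\<beta> * of_int (h T $ i) - x $ i\<bar> \<le> C"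
proof -
  obtain \<alpha> E :: real where \<alpha>: "0 < \<alpha>" and E: "0 \<le> E"
    and disc: "\<forall>\<tau> G K. \<tau> \<in> substitution_tilings \<xi> Ss H \<longrightarrow> compact G \<longrightarrow> G \<noteq> {} \<longrightarrow>
       (\<forall>P. cluster P \<longrightarrow> (\<forall>T\<in>P. T \<inter> frontier G \<noteq> {}) \<longrightarrow> real (card P) \<le> K) \<longrightarrow>
       \<bar>card {T \<in> \<tau>. T \<subseteq> G} - \<alpha> * measure lebesgue G\<bar> \<le> E * K"
    using tiling_discrepancy[OF pisot] by (elim exE conjE)
  note \<tau>' = substitution_tilingD[OF \<tau>]
  define \<beta> where "\<beta> = root CARD('d) (1 / \<alpha>)"
  have \<beta>: "0 < \<beta>" "\<alpha> * \<beta> ^ CARD('d) = 1" using \<alpha> by (simp_all add: \<beta>_def real_root_pow_pos2)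
  \<comment> \<open>One half of \<open>L\<^sup>d\<close> may be lost to the discrepancy of a single cube; the other half is left to
    compensate for the discrepancy of a union of cubes.\<close>
  obtain L :: nat where L: "0 < L" and Ldiam: "2 * max_diameter \<le> L * \<beta>"
    and Lsmall: "(2 * (E + 1)) * frontier_bound (L * \<beta>) \<le> real L ^ CARD('d)"
    by (rule frontier_bound_small[OF \<beta>(1)])
  define s where "s = L * \<beta>"
  define K where "K = frontier_bound s"
  define D where "D = L ^ CARD('d)"
  have s: "0 < s" "2 * max_diameter \<le> s" using L \<beta> Ldiam by (simp_all add: s_def)
  have \<alpha>s: "\<alpha> * s ^ CARD('d) = D" using \<beta>(2) by (simp add: s_def D_def power_mult_distrib)
  have K0: "0 \<le> K" unfolding K_def by (rule frontier_bound_nonneg[OF s(2)])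
  have EK: "2 * (E + 1) * K \<le> D" using Lsmall by (simp add: K_def s_def D_def)
  have tile_ne: "T \<noteq> {}" "interior T \<noteq> {}" "connected T" "bounded T" if "T \<in> \<tau>" for T
    using that \<tau>'(1) copy_tile tile_nonempty tile_interior_nonempty tile_connected tile_compact compact_imp_bounded
    by (metis subsetD)+
  define R where "R T z \<longleftrightarrow> (\<exists>q. cube s q \<inter> T \<noteq> {} \<and> adjacent q (cell L z))"
    for T :: "(real ^ 'd) set" and z
  have adj_sym: "adjacent p q \<longleftrightarrow> adjacent q p" for p q :: "int ^ 'd"
    by (simp add: adjacent_def abs_minus_commute)
  have adj_refl: "adjacent q q" for q :: "int ^ 'd" by (simp add: adjacent_def)
  have cubes_compact: "compact (\<Union>(cube s ` A))" if "finite A" for A :: "(int ^ 'd) set"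
    using that compact_cube by (intro compact_Union) auto
  have cubes_disc: "\<bar>card {T \<in> \<tau>. T \<subseteq> \<Union>(cube s ` A)} - real (card A * D)\<bar> \<le> E * (card (neighbours A - A) * K)"
    if A: "finite A" "A \<noteq> {}" for A :: "(int ^ 'd) set"
  proof -
    have "\<bar>card {T \<in> \<tau>. T \<subseteq> \<Union>(cube s ` A)} - \<alpha> * measure lebesgue (\<Union>(cube s ` A))\<bar> \<le> E * (card (neighbours A - A) * K)"
    proof (rule disc[rule_format, OF \<tau> cubes_compact[OF A(1)]])
      show "\<Union>(cube s ` A) \<noteq> {}" using A(2) cube_nonempty[of s] s(1) by auto
      show "real (card P) \<le> card (neighbours A - A) * K"
        if "cluster P" "\<And>T. T \<in> P \<Longrightarrow> T \<inter> frontier (\<Union>(cube s ` A)) \<noteq> {}" for P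
        unfolding K_def by (rule card_meeting_frontier_cubes[OF s A(1) that])
    qed
    moreover have "\<alpha> * measure lebesgue (\<Union>(cube s ` A)) = real (card A * D)"
      using measure_cubes[OF s(1) A(1)] \<alpha>s by simp
    ultimately show ?thesis by simp
  qed
  have one_cube: "E * K \<le> card {T \<in> \<tau>. T \<subseteq> cube s q}" for q
  proof -
    have "\<bar>card {T \<in> \<tau>. T \<subseteq> cube s q} - \<alpha> * measure lebesgue (cube s q)\<bar> \<le> E * K"
    proof (rule disc[rule_format, OF \<tau> compact_cube])
      show "cube s q \<noteq> {}" using cube_nonempty[of s q] s(1) by simp
      show "real (card P) \<le> K" if "cluster P" "\<And>T. T \<in> P \<Longrightarrow> T \<inter> frontier (cube s q) \<noteq> {}" for P
        unfolding K_def by (rule card_meeting_frontier_cube[OF that s(2)])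
    qed
    moreover have "\<alpha> * measure lebesgue (cube s q) = D" using \<alpha>s s(1) by (simp add: measure_cube)
    moreover have "2 * (E * K) \<le> 2 * (E + 1) * K" using K0 by (simp add: algebra_simps)
    ultimately show ?thesis using EK by linarith
  qed
  have fin_meet: "finite {q. cube s q \<inter> T \<noteq> {}}" if "T \<in> \<tau>" for T
    by (rule finite_cubes_meeting[OF s(1) tile_ne(4)[OF that]])
  have finA: "finite {z \<in> UNIV. R T z}" if T: "T \<in> \<tau>" for T
  proof -
    have "{z \<in> UNIV. R T z} = {z. cell L z \<in> neighbours {q. cube s q \<inter> T \<noteq> {}}}"
      unfolding R_def neighbours_def by blast
    then show ?thesis using card_cell(1)[OF L finite_neighbours[OF fin_meet[OF T]]] by simp
  qed
  have finB: "finite {T \<in> \<tau>. R T z}" for z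
  proof (rule finite_subset)
    have "finite (neighbours {cell L z})" by (rule finite_neighbours) simp
    then show "finite {T \<in> \<tau>. T \<inter> \<Union>(cube s ` neighbours {cell L z}) \<noteq> {}}"
      by (intro finite_tiles_meeting[OF \<tau>] compact_imp_bounded cubes_compact)
    show "{T \<in> \<tau>. R T z} \<subseteq> {T \<in> \<tau>. T \<inter> \<Union>(cube s ` neighbours {cell L z}) \<noteq> {}}"
      unfolding R_def neighbours_def using adj_sym by blast
  qed
  have hallA: "card J \<le> card {z \<in> UNIV. \<exists>T\<in>J. R T z}" if J: "J \<subseteq> \<tau>" "finite J" for J
  proof (cases "J = {}")
    case False
    define A where "A = {q. cube s q \<inter> \<Union>J \<noteq> {}}"
    let ?G = "\<Union>(cube s ` A)"
    have A_eq: "A = (\<Union>T\<in>J. {q. cube s q \<inter> T \<noteq> {}})" unfolding A_def by blast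
    have finA': "finite A" unfolding A_eq using J fin_meet by blast
    have meet: "T \<inter> ?G \<noteq> {}" if T: "T \<in> J" for T
    proof -
      obtain x where x: "x \<in> T" using tile_ne(1) J(1) T by blast
      obtain q where "x \<in> cube s q" by (rule cube_covers[OF s(1)])
      then show ?thesis using x T unfolding A_def by blast
    qed
    then have "A \<noteq> {}" using False by blast
    have fG: "finite {T \<in> \<tau>. T \<inter> ?G \<noteq> {}}"
      by (rule finite_tiles_meeting[OF \<tau> compact_imp_bounded[OF cubes_compact[OF finA']]])
    let ?I = "{T \<in> \<tau>. T \<subseteq> ?G}" and ?F = "{T \<in> \<tau>. T \<inter> frontier ?G \<noteq> {}}"
    have "frontier ?G \<subseteq> ?G"
      using compact_imp_closed[OF cubes_compact[OF finA']] by (simp add: frontier_def closure_closed Diff_subset)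
    then have fF: "finite ?F" by (intro finite_subset[OF _ fG]) blast
    have fI: "finite ?I"
    proof (rule finite_subset[OF _ fG])
      show "?I \<subseteq> {T \<in> \<tau>. T \<inter> ?G \<noteq> {}}" using tile_ne(1) by blast
    qed
    have "cluster ?F"
      unfolding cluster_def using fF \<tau>'(1,2) by (auto intro: pairwise_subset)
    then have cF: "card ?F \<le> card (neighbours A - A) * K"
      unfolding K_def by (intro card_meeting_frontier_cubes[OF s finA']) auto
    have "J \<subseteq> ?I \<union> ?F"
    proof
      fix T assume T: "T \<in> J"
      have "T \<subseteq> ?G \<or> T \<inter> frontier ?G \<noteq> {}"
        using connected_Int_frontier[OF tile_ne(3) meet[OF T]] J(1) T by blast
      then show "T \<in> ?I \<union> ?F" using J(1) T by blast
    qed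
    then have "card J \<le> card (?I \<union> ?F)" using fI fF by (intro card_mono) auto
    also have "\<dots> \<le> card ?I + card ?F" by (rule card_Un_le)
    finally have "real (card J) \<le> real (card ?I) + real (card ?F)" by linarith
    also have "\<dots> \<le> card A * D + E * (card (neighbours A - A) * K) + card (neighbours A - A) * K"
      using cubes_disc[OF finA' \<open>A \<noteq> {}\<close>] cF by linarith
    also have "\<dots> = card A * D + card (neighbours A - A) * ((E + 1) * K)" by (simp add: algebra_simps)
    also have "\<dots> \<le> card A * D + card (neighbours A - A) * real D"
    proof -
      have "0 \<le> (E + 1) * K" using E K0 by simp
      moreover have "2 * (E + 1) * K = (E + 1) * K + (E + 1) * K" by simp
      ultimately have "(E + 1) * K \<le> D" using EK by linarith
      then show ?thesis by (intro add_left_mono mult_left_mono) auto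
    qed
    also have "\<dots> = real (card (neighbours A) * D)"
    proof -
      have "card (neighbours A) = card A + card (neighbours A - A)"
        using neighbours_superset[of A] finite_neighbours[OF finA'] finA'
        by (metis card_Diff_subset card_mono le_add_diff_inverse)
      then show ?thesis by (simp add: distrib_right)
    qed
    also have "card (neighbours A) * D = card {z. cell L z \<in> neighbours A}"
      unfolding D_def by (rule card_cell(2)[OF L finite_neighbours[OF finA'], symmetric])
    also have "{z. cell L z \<in> neighbours A} = {z \<in> UNIV. \<exists>T\<in>J. R T z}"
      unfolding neighbours_def R_def A_eq by blast
    finally show ?thesis by simp
  qed simp
  have hallB: "card J \<le> card {T \<in> \<tau>. \<exists>z\<in>J. R T z}" if J: "finite J" for J
  proof (cases "J = {}")
    case False
    define A where "A = cell L ` J"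
    have A: "finite A" "A \<noteq> {}" using J False by (simp_all add: A_def)
    let ?B = "neighbours A - A" and ?G = "\<Union>(cube s ` A)"
    let ?I = "{T \<in> \<tau>. T \<subseteq> ?G}" and ?c = "\<lambda>q. {T \<in> \<tau>. T \<subseteq> cube s q}"
    have finB': "finite ?B" using finite_neighbours[OF A(1)] by simp
    have fin_in: "finite {T \<in> \<tau>. T \<subseteq> U}" if "bounded U" for U
      using finite_tiles_meeting[OF \<tau> that] by (rule finite_subset[rotated]) (use tile_ne(1) in blast)
    have dis: "T \<noteq> T'" if T: "T \<in> \<tau>" "T \<subseteq> cube s q" and T': "T' \<subseteq> \<Union>(cube s ` A')" and q: "q \<notin> A'" for T T' q A'
    proof
      assume "T = T'"
      obtain x where "x \<in> interior T" using tile_ne(2)[OF T(1)] by blast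
      then have "x \<in> interior (cube s q)" "x \<in> T'"
        using interior_mono[OF T(2)] interior_subset \<open>T = T'\<close> by blast+
      then obtain p where "p \<in> A'" "x \<in> cube s p" using T' by blast
      then show False using interior_cube_disjoint[OF s(1), of q p] \<open>x \<in> interior (cube s q)\<close> q by blast
    qed
    have "J \<subseteq> {z. cell L z \<in> A}" unfolding A_def by blast
    then have "card J \<le> card {z. cell L z \<in> A}" using card_cell(1)[OF L A(1)] by (rule card_mono[rotated])
    then have "card J \<le> card A * D" unfolding D_def card_cell(2)[OF L A(1)] .
    then have "real (card J) \<le> real (card A * D)" by (rule of_nat_mono)
    also have "\<dots> \<le> card ?I + E * (card ?B * K)" using cubes_disc[OF A] by linarith
    also have "\<dots> = card ?I + (\<Sum>q\<in>?B. E * K)" by simp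
    also have "\<dots> \<le> card ?I + (\<Sum>q\<in>?B. real (card (?c q)))"
      by (intro add_left_mono sum_mono one_cube)
    also have "\<dots> = real (card ?I + (\<Sum>q\<in>?B. card (?c q)))" by simp
    also have "(\<Sum>q\<in>?B. card (?c q)) = card (\<Union>q\<in>?B. ?c q)"
    proof (rule card_UN_disjoint[symmetric, OF finB'])
      show "\<forall>q\<in>?B. finite (?c q)" using fin_in compact_imp_bounded[OF compact_cube] by blast
      show "\<forall>p\<in>?B. \<forall>q\<in>?B. p \<noteq> q \<longrightarrow> ?c p \<inter> ?c q = {}" using dis[where A' = "{q}" for q] by auto
    qed
    also have "card ?I + card (\<Union>q\<in>?B. ?c q) = card (?I \<union> (\<Union>q\<in>?B. ?c q))"
    proof (rule card_Un_disjoint[symmetric])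
      show "finite ?I" by (rule fin_in[OF compact_imp_bounded[OF cubes_compact[OF A(1)]]])
      show "finite (\<Union>q\<in>?B. ?c q)" using finB' fin_in compact_imp_bounded[OF compact_cube] by blast
      show "?I \<inter> (\<Union>q\<in>?B. ?c q) = {}" using dis by blast
    qed
    finally have "card J \<le> card (?I \<union> (\<Union>q\<in>?B. ?c q))" by simp
    also have "\<dots> \<le> card {T \<in> \<tau>. \<exists>z\<in>J. R T z}"
    proof (rule card_mono)
      have "{T \<in> \<tau>. \<exists>z\<in>J. R T z} = (\<Union>z\<in>J. {T \<in> \<tau>. R T z})" by blast
      then show "finite {T \<in> \<tau>. \<exists>z\<in>J. R T z}" using J finB by simp
      have "\<exists>z\<in>J. R T z" if T: "T \<in> \<tau>" "T \<subseteq> ?G" for T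
      proof -
        obtain x where "x \<in> T" using tile_ne(1)[OF T(1)] by blast
        then obtain z where "z \<in> J" "x \<in> cube s (cell L z)" using T(2) unfolding A_def by blast
        then show ?thesis unfolding R_def using adj_refl \<open>x \<in> T\<close> by blast
      qed
      moreover have "\<exists>z\<in>J. R T z" if T: "T \<in> \<tau>" "T \<subseteq> cube s q" "q \<in> neighbours A" for T q
      proof -
        obtain z where "z \<in> J" "adjacent (cell L z) q" using T(3) unfolding neighbours_def A_def by blast
        moreover have "cube s q \<inter> T \<noteq> {}" using tile_ne(1)[OF T(1)] T(2) by blast
        ultimately show ?thesis unfolding R_def using adj_sym by blast
      qed
      ultimately show "?I \<union> (\<Union>q\<in>?B. ?c q) \<subseteq> {T \<in> \<tau>. \<exists>z\<in>J. R T z}" by blast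
    qed
    finally show ?thesis .
  qed simp
  obtain h :: "(real ^ 'd) set \<Rightarrow> int ^ 'd" where h: "bij_betw h \<tau> UNIV" "\<forall>T\<in>\<tau>. R T (h T)"
    using Hall_two_sided[of \<tau> UNIV R, OF finA finB hallA hallB] by blast
  have "\<bar>\<beta> * of_int (h T $ i) - x $ i\<bar> \<le> 2 * s + max_diameter" if T: "T \<in> \<tau>" "x \<in> T" for T x i
  proof -
    obtain q y where q: "adjacent q (cell L (h T))" and y: "y \<in> cube s q" "y \<in> T"
      using h(2) T(1) unfolding R_def by blast
    let ?z = "h T $ i" and ?c = "cell L (h T) $ i"
    have "?z = int L * ?c + ?z mod int L" by (simp add: cell_def)
    moreover have "0 \<le> ?z mod int L" "?z mod int L < int L" using L by simp_all
    ultimately have "int L * ?c \<le> ?z" "?z \<le> int L * (?c + 1)"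
      unfolding distrib_left mult_1_right by linarith+
    then have "real_of_int (int L * ?c) \<le> of_int ?z" "real_of_int ?z \<le> of_int (int L * (?c + 1))"
      by (simp_all only: of_int_le_iff)
    then have "\<beta> * (real L * of_int ?c) \<le> \<beta> * of_int ?z" "\<beta> * of_int ?z \<le> \<beta> * (real L * (of_int ?c + 1))"
      using \<beta>(1) by (simp_all add: mult_left_mono)
    then have z: "s * of_int ?c \<le> \<beta> * of_int ?z" "\<beta> * of_int ?z \<le> s * (of_int ?c + 1)"
      by (simp_all add: s_def mult_ac)
    have "\<bar>q $ i - ?c\<bar> \<le> 1" using q by (simp add: adjacent_def)
    then have "real_of_int (q $ i) \<le> of_int ?c + 1" "real_of_int ?c \<le> of_int (q $ i) + 1" by linarith+
    then have "s * of_int (q $ i) \<le> s * (of_int ?c + 1)" "s * of_int ?c \<le> s * (of_int (q $ i) + 1)"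
      using s(1) by (simp_all add: mult_left_mono)
    moreover have "s * of_int (q $ i) \<le> y $ i" "y $ i \<le> s * (of_int (q $ i) + 1)"
      using y(1) by (simp_all add: mem_cube)
    moreover have "\<bar>x $ i - y $ i\<bar> \<le> max_diameter"
      using component_le_norm_cart[of "x - y" i] dist_le_max_diameter[of T x y] T y \<tau>'(1)
      by (auto simp: dist_norm)
    ultimately show ?thesis using z by (simp add: distrib_left abs_le_iff)
  qed
  then show ?thesis using that[OF \<beta>(1) h(1)] by blast
qed

end

lemma is_norm_le_sum:
  fixes N :: "real ^ 'd \<Rightarrow> real"
  assumes N: "is_norm N"
  shows "N v \<le> (\<Sum>i\<in>UNIV. \<bar>v $ i\<bar> * N (axis i 1))"
proof -
  have sub: "N (\<Sum>i\<in>I. f i) \<le> (\<Sum>i\<in>I. N (f i))" if "finite I" for f :: "'d \<Rightarrow> real ^ 'd" and I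
    using that
  proof induction
    case empty
    have "N 0 = 0" using N unfolding is_norm_def by blast
    then show ?case by simp
  next
    case (insert i I)
    have "N (f i + (\<Sum>j\<in>I. f j)) \<le> N (f i) + N (\<Sum>j\<in>I. f j)" using N by (simp add: is_norm_def)
    then show ?case using insert by simp
  qed
  have "v = (\<Sum>i\<in>UNIV. v $ i *\<^sub>R axis i 1)"
    using basis_expansion[of v] by (simp add: scalar_mult_eq_scaleR)
  then have "N v \<le> (\<Sum>i\<in>UNIV. N (v $ i *\<^sub>R axis i 1))" using sub[of UNIV "\<lambda>i. v $ i *\<^sub>R axis i 1"] by simp
  then show ?thesis using N by (simp add: is_norm_def)
qed

lemma bij_betw_scaled_lattice:
  fixes \<beta> :: real
  assumes "0 < \<beta>"
  defines "g \<equiv> \<lambda>z :: int ^ 'd. \<beta> *\<^sub>R (\<chi> i. real_of_int (z $ i))"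
  shows "bij_betw g UNIV (scaled_lattice \<beta>)"
proof (rule bij_betw_imageI)
  show "inj g"
    using assms(1) unfolding g_def by (intro injI) (simp add: Finite_Cartesian_Product.vec_eq_iff)
  show "range g = scaled_lattice \<beta>"
  proof (intro equalityI subsetI)
    fix x :: "real ^ 'd" assume "x \<in> scaled_lattice \<beta>"
    then obtain w where w: "x = \<beta> *\<^sub>R w" "\<forall>i. w $ i \<in> \<int>" by (auto simp: scaled_lattice_def)
    have "w = (\<chi> i. real_of_int ((\<chi> i. \<lfloor>w $ i\<rfloor>) $ i))"
      using w(2) by (simp add: Finite_Cartesian_Product.vec_eq_iff)
    then have "x = g (\<chi> i. \<lfloor>w $ i\<rfloor>)" unfolding w(1) g_def by simp
    then show "x \<in> range g" by (rule range_eqI)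
  qed (auto simp: scaled_lattice_def g_def)
qed

theorem theorem1p4:
  fixes N :: "real ^ 'd \<Rightarrow> real"
    and \<xi> :: real
    and Ss :: "(real ^ 'd) set list"
    and H :: "(real ^ 'd) set \<Rightarrow> (real ^ 'd) set set"
    and \<tau> :: "(real ^ 'd) set set"
    and Y :: "(real ^ 'd) set"
  assumes "is_norm N"
    and "pisot_substitution \<xi> Ss H"
    and "\<tau> \<in> substitution_tilings \<xi> Ss H"
    and "separated_net N Y"
    and "net_of_tiling \<tau> Y"
  shows "\<exists>\<beta>>0. \<exists>\<Phi>. bij_betw \<Phi> Y (scaled_lattice \<beta>) \<and>
           bdd_above ((\<lambda>y. N (\<Phi> y - y)) ` Y)"
proof -
  interpret tile_substitution \<xi> Ss H
    using assms(2) by unfold_locales (simp add: pisot_substitution_def primitive_substitution_def)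
  obtain \<beta> C :: real and h :: "(real ^ 'd) set \<Rightarrow> int ^ 'd" where \<beta>: "0 < \<beta>"
    and h: "bij_betw h \<tau> UNIV"
    and C: "\<And>T x i. T \<in> \<tau> \<Longrightarrow> x \<in> T \<Longrightarrow> \<bar>\<beta> * of_int (h T $ i) - x $ i\<bar> \<le> C"
    using tiles_to_lattice[OF assms(2,3)] by metis
  obtain y where y: "bij_betw y \<tau> Y" "\<And>T. T \<in> \<tau> \<Longrightarrow> y T \<in> T"
    using assms(5) by (auto simp: net_of_tiling_def)
  define t where "t = inv_into \<tau> y"
  have t: "bij_betw t Y \<tau>" unfolding t_def by (rule bij_betw_inv_into[OF y(1)])
  have t_in: "t x \<in> \<tau>" "x \<in> t x" if "x \<in> Y" for x
  proof -
    show "t x \<in> \<tau>" using t that by (auto dest: bij_betwE)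
    then show "x \<in> t x" using y(2)[of "t x"] bij_betw_inv_into_right[OF y(1) that] by (simp add: t_def)
  qed
  define g :: "int ^ 'd \<Rightarrow> real ^ 'd" where "g z = \<beta> *\<^sub>R (\<chi> i. of_int (z $ i))" for z
  have g: "bij_betw g UNIV (scaled_lattice \<beta>)"
    unfolding g_def[abs_def] by (rule bij_betw_scaled_lattice[OF \<beta>])
  have "bij_betw (g \<circ> (h \<circ> t)) Y (scaled_lattice \<beta>)"
    by (rule bij_betw_trans[OF bij_betw_trans[OF t h] g])
  moreover have "N ((g \<circ> (h \<circ> t)) x - x) \<le> (\<Sum>i\<in>UNIV. C * N (axis i 1))" if x: "x \<in> Y" for x
  proof -
    have "N ((g \<circ> (h \<circ> t)) x - x) \<le> (\<Sum>i\<in>UNIV. \<bar>((g \<circ> (h \<circ> t)) x - x) $ i\<bar> * N (axis i 1))"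
      by (rule is_norm_le_sum[OF assms(1)])
    also have "\<dots> \<le> (\<Sum>i\<in>UNIV. C * N (axis i 1))"
    proof (intro sum_mono mult_right_mono)
      show "\<bar>((g \<circ> (h \<circ> t)) x - x) $ i\<bar> \<le> C" for i
        using C[OF t_in[OF x], of i] by (simp add: g_def)
      show "0 \<le> N (axis i 1)" for i using assms(1) by (simp add: is_norm_def)
    qed
    finally show ?thesis .
  qed
  then have "bdd_above ((\<lambda>x. N ((g \<circ> (h \<circ> t)) x - x)) ` Y)" by (rule bdd_aboveI2)
  ultimately show ?thesis using \<beta> by blast
qed

end
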